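(* For every prime $p$ and every positive integer $t$, setting $m=p^{t+1}$, $l=p^t$ and $n=(p^{t+1}+1)\sum_{i=1}^{t+1}p^i$, there exists a tight $(n,l)$-OGFF for $\mathbb C^m$.
   Context: An $(n,l)$-packing for $\mathbb C^m$ is a sequence $\mathcal P=\{P_j\}_{j=1}^n$ of rank-$l$ orthogonal projections on $\mathbb C^m$; its coherence is $\mu(\mathcal P)=\max_{j\neq j'}\operatorname{tr}(P_jP_{j'})$. It is an $(n,l)$-fusion frame if $\sum_jP_j$ is positive definite, and it is tight if $\sum_{j=1}^nP_j=\frac{nl}{m}I_m$. An $(n,l)$-OGFF (orthoplectic Grassmannian fusion frame) for $\mathbb C^m$ is an $(n,l)$-fusion frame $\mathcal P$ for $\mathbb C^m$ with $n>d_{\mathbb C^m}+1$, where $d_{\mathbb C^m}=m^2-1$, and $\mu(\mathcal P)=\frac{l^2}{m}$. *)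

theory Defs
  imports
    "HOL-Computational_Algebra.Primes"
    "Jordan_Normal_Form.Schur_Decomposition"
    "Jordan_Normal_Form.DL_Rank"
begin

text \<open>
  The dimension of the ambient space varies, so operators on the complex coordinate space of
  dimension \<open>m\<close> are represented by complex matrices in \<open>carrier_mat m m\<close>.
\<close>

definition hermitian_mat :: "complex mat \<Rightarrow> bool" where
  "hermitian_mat A \<longleftrightarrow> mat_adjoint A = A"

definition orthogonal_projection :: "nat \<Rightarrow> complex mat \<Rightarrow> bool" where
  "orthogonal_projection m P \<longleftrightarrow> P \<in> carrier_mat m m \<and> hermitian_mat P \<and> P * P = P"

text \<open>
  The quadratic form of a Hermitian matrix is real-valued, so taking the real part below
  discards nothing.
\<close>

definition positive_definite_mat :: "nat \<Rightarrow> complex mat \<Rightarrow> bool" where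
  "positive_definite_mat m A \<longleftrightarrow> A \<in> carrier_mat m m \<and> hermitian_mat A \<and>
     (\<forall>v \<in> carrier_vec m. v \<noteq> 0\<^sub>v m \<longrightarrow> Re ((A *\<^sub>v v) \<bullet>c v) > 0)"

definition mat_trace :: "complex mat \<Rightarrow> complex" where
  "mat_trace A = (\<Sum>i<dim_row A. A $$ (i, i))"

text \<open>
  Matrices do not form a type-class monoid (there is no dimension-independent zero), so the
  sum of a sequence of matrices is formed entrywise.
\<close>

definition mat_seq_sum :: "nat \<Rightarrow> nat \<Rightarrow> (nat \<Rightarrow> complex mat) \<Rightarrow> complex mat" where
  "mat_seq_sum m n P = mat m m (\<lambda>(a, b). \<Sum>j = 1..n. P j $$ (a, b))"

text \<open>
  Sequences of length \<open>n\<close> are functions on \<open>nat\<close> of which only the values on \<open>{1..n}\<close> matter.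
\<close>

definition packing :: "nat \<Rightarrow> nat \<Rightarrow> nat \<Rightarrow> (nat \<Rightarrow> complex mat) \<Rightarrow> bool" where
  "packing m n l P \<longleftrightarrow>
     (\<forall>j \<in> {1..n}. orthogonal_projection m (P j) \<and> vec_space.rank m (P j) = l)"

text \<open>
  The trace of a product of two Hermitian matrices is real.  The maximum is taken over a
  nonempty set as soon as \<open>n \<ge> 2\<close>.
\<close>

definition coherence :: "nat \<Rightarrow> (nat \<Rightarrow> complex mat) \<Rightarrow> real" where
  "coherence n P =
     Max {Re (mat_trace (P j * P j')) | j j'. j \<in> {1..n} \<and> j' \<in> {1..n} \<and> j \<noteq> j'}"

definition fusion_frame :: "nat \<Rightarrow> nat \<Rightarrow> nat \<Rightarrow> (nat \<Rightarrow> complex mat) \<Rightarrow> bool" where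
  "fusion_frame m n l P \<longleftrightarrow> packing m n l P \<and> positive_definite_mat m (mat_seq_sum m n P)"

definition tight :: "nat \<Rightarrow> nat \<Rightarrow> nat \<Rightarrow> (nat \<Rightarrow> complex mat) \<Rightarrow> bool" where
  "tight m n l P \<longleftrightarrow>
     mat_seq_sum m n P = (of_nat (n * l) / of_nat m) \<cdot>\<^sub>m 1\<^sub>m m"

text \<open>
  The real dimension of the space of traceless Hermitian \<open>m\<close> by \<open>m\<close> matrices (for \<open>m \<ge> 1\<close>).
\<close>

definition d_complex :: "nat \<Rightarrow> nat" where
  "d_complex m = m\<^sup>2 - 1"

text \<open>Orthoplectic Grassmannian fusion frames.\<close>

definition ogff :: "nat \<Rightarrow> nat \<Rightarrow> nat \<Rightarrow> (nat \<Rightarrow> complex mat) \<Rightarrow> bool" where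
  "ogff m n l P \<longleftrightarrow> fusion_frame m n l P \<and> n > d_complex m + 1 \<and>
     coherence n P = (real l)\<^sup>2 / real m"

end

theory Submission
  imports Defs "HOL-Number_Theory.Cong" "HOL-Library.FuncSet"
begin

text \<open>
  Take \<open>m + 1\<close> mutually unbiased bases of the space of functions on \<open>F_p ^ (t + 1)\<close> and, for each
  basis and each affine hyperplane, the projection onto the span of the basis vectors indexed by that
  hyperplane. For two projections from one basis the trace of the product is the size of the
  intersection of the hyperplanes, which is \<open>0\<close> or \<open>p ^ (t - 1)\<close>; for different bases unbiasedness
  gives \<open>l * l / m = p ^ (t - 1)\<close>. Every point lies on equally many hyperplanes, hence tightness.

  The bases are the standard basis and the chirps \<open>x \<mapsto> zeta ^ (x\<^sup>T M x) * omega ^ (b \<cdot> x)\<close> with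
  \<open>zeta\<^sup>2 = omega\<close>, where \<open>M\<close> runs through \<open>p ^ (t + 1)\<close> symmetric matrices whose differences are
  invertible modulo \<open>p\<close>. With \<open>zeta\<close> of order dividing \<open>p\<^sup>2\<close> this covers odd \<open>p\<close> and \<open>p = 2\<close> alike.
  The matrices represent the forms \<open>(x, y) \<mapsto> T (a x y)\<close> on the field with \<open>p ^ (t + 1)\<close> elements,
  which is obtained as a quotient of \<open>\<int>[X]\<close> in which \<open>X\<close> becomes a primitive root of unity of order
  \<open>p ^ (t + 1) - 1\<close>.
\<close>

section \<open>Ideals\<close>

definition is_ideal :: "'a::comm_ring_1 set \<Rightarrow> bool" where
  "is_ideal I \<longleftrightarrow> 0 \<in> I \<and> (\<forall>x\<in>I. \<forall>y\<in>I. x + y \<in> I) \<and> (\<forall>r. \<forall>x\<in>I. r * x \<in> I)"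

text \<open>Maximality is stated as invertibility modulo \<open>I\<close>, the form in which it is
  used: the quotient is a field. No quotient type is formed; \<open>x - y \<in> I\<close> stands for
  equality in it.\<close>

definition max_ideal :: "'a::comm_ring_1 set \<Rightarrow> bool" where
  "max_ideal I \<longleftrightarrow> is_ideal I \<and> 1 \<notin> I \<and> (\<forall>x. x \<notin> I \<longrightarrow> (\<exists>y. x * y - 1 \<in> I))"

lemma ideal_0: "is_ideal I \<Longrightarrow> 0 \<in> I"
  and ideal_add: "is_ideal I \<Longrightarrow> x \<in> I \<Longrightarrow> y \<in> I \<Longrightarrow> x + y \<in> I"
  and ideal_mult: "is_ideal I \<Longrightarrow> x \<in> I \<Longrightarrow> r * x \<in> I"
  by (auto simp: is_ideal_def)

lemma ideal_mult_right: "is_ideal I \<Longrightarrow> x \<in> I \<Longrightarrow> x * r \<in> I"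
  by (metis ideal_mult mult.commute)

lemma ideal_diff: "is_ideal I \<Longrightarrow> x \<in> I \<Longrightarrow> y \<in> I \<Longrightarrow> x - y \<in> I"
  using ideal_add[of I x "(-1) * y"] ideal_mult[of I y "-1"] by simp

lemma ideal_uminus: "is_ideal I \<Longrightarrow> x \<in> I \<Longrightarrow> - x \<in> I"
  using ideal_diff[of I 0 x] ideal_0 by auto

lemma ideal_sum: "is_ideal I \<Longrightarrow> (\<And>x. x \<in> A \<Longrightarrow> f x \<in> I) \<Longrightarrow> sum f A \<in> I"
  by (induction A rule: infinite_finite_induct) (auto simp: ideal_0 ideal_add)

lemma ideal_dvd: "is_ideal I \<Longrightarrow> x \<in> I \<Longrightarrow> x dvd y \<Longrightarrow> y \<in> I"
  by (auto simp: ideal_mult_right elim!: dvdE)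

lemma ideal_cong_trans: "is_ideal I \<Longrightarrow> x - y \<in> I \<Longrightarrow> y - z \<in> I \<Longrightarrow> x - z \<in> I"
  using ideal_add[of I "x - y" "y - z"] by simp

lemma ideal_cong_sym: "is_ideal I \<Longrightarrow> x - y \<in> I \<Longrightarrow> y - x \<in> I"
  using ideal_uminus[of I "x - y"] by simp

lemma max_ideal_prime:
  assumes "max_ideal I" "x * y \<in> I" "x \<notin> I"
  shows "y \<in> I"
proof -
  have I: "is_ideal I" using assms(1) by (simp add: max_ideal_def)
  obtain u where u: "x * u - 1 \<in> I" using assms(1,3) unfolding max_ideal_def by blast
  have "u * (x * y) - y * (x * u - 1) \<in> I"
    by (rule ideal_diff[OF I ideal_mult[OF I assms(2)] ideal_mult[OF I u]])
  also have "u * (x * y) - y * (x * u - 1) = y" by (simp add: algebra_simps)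
  finally show ?thesis .
qed

text \<open>Zorn's lemma is applied to the ideals above \<open>J\<close> that avoid 1. For
  \<open>x\<close> outside a maximal such \<open>M\<close>, the ideal generated by \<open>M\<close>
  and \<open>x\<close> contains 1, and writing 1 as \<open>m + x * y\<close> gives the
  inverse.\<close>

lemma ex_max_ideal:
  assumes "is_ideal J" "1 \<notin> J"
  shows "\<exists>I. J \<subseteq> I \<and> max_ideal I"
proof -
  define A where "A = {I. is_ideal I \<and> J \<subseteq> I \<and> 1 \<notin> I}"
  have "\<exists>M\<in>A. \<forall>X\<in>A. M \<subseteq> X \<longrightarrow> X = M"
  proof (rule subset_Zorn_nonempty)
    show "A \<noteq> {}" using assms by (auto simp: A_def)
    fix C assume C: "C \<noteq> {}" "subset.chain A C"
    have id: "is_ideal I" and J: "J \<subseteq> I" and n1: "1 \<notin> I" if "I \<in> C" for I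
      using that C by (auto simp: A_def subset_chain_def)
    have "x + y \<in> \<Union>C" if xy: "x \<in> \<Union>C" "y \<in> \<Union>C" for x y
    proof -
      obtain K L where KL: "K \<in> C" "L \<in> C" "x \<in> K" "y \<in> L" using xy by auto
      then have "K \<subseteq> L \<or> L \<subseteq> K" using C by (auto simp: subset_chain_def)
      then show ?thesis using KL id ideal_add by (metis Union_iff subsetD)
    qed
    moreover have "r * x \<in> \<Union>C" if "x \<in> \<Union>C" for r x
      using that id ideal_mult by blast
    moreover have "0 \<in> \<Union>C" using C id ideal_0 by blast
    ultimately have "is_ideal (\<Union>C)" by (simp only: is_ideal_def) blast
    then show "\<Union>C \<in> A" using C J n1 by (auto simp: A_def)
  qed
  then obtain M where M: "is_ideal M" "J \<subseteq> M" "1 \<notin> M"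
    and max: "\<And>X. is_ideal X \<Longrightarrow> 1 \<notin> X \<Longrightarrow> M \<subseteq> X \<Longrightarrow> X = M"
    by (auto simp: A_def)
  have "\<exists>y. x * y - 1 \<in> M" if x: "x \<notin> M" for x
  proof -
    define X where "X = {m + x * y | m y. m \<in> M}"
    have "is_ideal X"
      unfolding is_ideal_def
    proof (intro conjI ballI allI)
      have "0 = 0 + x * 0" by simp
      then show "0 \<in> X" using ideal_0[OF M(1)] unfolding X_def by blast
      fix a assume "a \<in> X"
      then obtain m y where a: "a = m + x * y" "m \<in> M" by (auto simp: X_def)
      show "r * a \<in> X" for r
      proof -
        have "r * a = r * m + x * (r * y)" by (simp add: a algebra_simps)
        then show ?thesis using ideal_mult[OF M(1) a(2)] unfolding X_def by blast
      qed
      fix b assume "b \<in> X"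
      then obtain m' y' where b: "b = m' + x * y'" "m' \<in> M" by (auto simp: X_def)
      have "a + b = (m + m') + x * (y + y')" by (simp add: a b algebra_simps)
      then show "a + b \<in> X" using ideal_add[OF M(1) a(2) b(2)] unfolding X_def by blast
    qed
    moreover have "M \<subseteq> X"
    proof
      fix m assume "m \<in> M"
      then have "m = m + x * 0 \<and> m \<in> M" by simp
      then show "m \<in> X" unfolding X_def by blast
    qed
    moreover have "x \<in> X"
    proof -
      have "x = 0 + x * 1" by simp
      then show ?thesis using ideal_0[OF M(1)] unfolding X_def by blast
    qed
    ultimately have "1 \<in> X" using max x by blast
    then obtain m y where "1 = m + x * y" "m \<in> M" by (auto simp: X_def)
    then have "x * y - 1 = - m" by (simp add: algebra_simps)
    then show ?thesis using ideal_uminus[OF M(1) \<open>m \<in> M\<close>] by metis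
  qed
  then show ?thesis using M by (auto simp: max_ideal_def)
qed

text \<open>The usual root count over a field, carried out on pairwise incongruent representatives.
  After splitting off a root \<open>s\<close>, every other element of \<open>S\<close> is a root of
  the quotient polynomial because \<open>I\<close> is prime. The leading coefficient 1 keeps the
  degree from dropping modulo \<open>I\<close>.\<close>

lemma card_roots_mod_max_ideal:
  fixes g :: "'a::comm_ring_1 poly"
  assumes I: "max_ideal I"
  shows "lead_coeff g = 1 \<Longrightarrow> finite S \<Longrightarrow> (\<And>x y. x \<in> S \<Longrightarrow> y \<in> S \<Longrightarrow> x - y \<in> I \<Longrightarrow> x = y) \<Longrightarrow>
    (\<And>x. x \<in> S \<Longrightarrow> poly g x \<in> I) \<Longrightarrow> card S \<le> degree g"
proof (induction "degree g" arbitrary: g S)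
  case 0
  then have "g = 1"
    by (metis degree_0_id one_pCons)
  then have "S = {}" using 0 I by (auto simp: max_ideal_def)
  then show ?case by simp
next
  case (Suc n)
  have id: "is_ideal I" using I by (simp add: max_ideal_def)
  show ?case
  proof (cases "S = {}")
    case False
    then obtain s where s: "s \<in> S" by auto
    define h where "h = synthetic_div g s"
    have g: "g = [:- s, 1:] * h + [:poly g s:]"
      using synthetic_div_correct'[of s g] by (simp add: h_def)
    have dh: "degree h = n" using Suc(2) by (simp add: h_def degree_synthetic_div)
    have "lead_coeff h = 1"
    proof -
      have "coeff g (Suc n) = coeff h n"
        by (subst g, simp add: dh coeff_eq_0)
      then show ?thesis using Suc dh by simp
    qed
    moreover have "poly h x \<in> I" if "x \<in> S - {s}" for x
    proof -
      have "poly g x = (x - s) * poly h x + poly g s"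
        by (subst g) (simp add: algebra_simps)
      then have "(x - s) * poly h x = poly g x - poly g s" by simp
      then have "(x - s) * poly h x \<in> I"
        using ideal_diff[OF id Suc(6)[of x] Suc(6)[of s]] that s by auto
      moreover have "x - s \<notin> I" using Suc(5)[of x s] that s by auto
      ultimately show ?thesis using max_ideal_prime[OF I] by blast
    qed
    ultimately have "card (S - {s}) \<le> degree h"
      using Suc.hyps(1)[of h "S - {s}"] Suc.prems dh by auto
    then show ?thesis using s Suc(2) Suc(4) dh by (simp add: card_Diff_singleton)
  qed simp
qed

section \<open>The Frobenius map and Fermat's little theorem\<close>

lemma prime_power_sum_expand:
  fixes x y :: "'a::comm_ring_1"
  assumes "prime p"
  shows "\<exists>c. (x + y) ^ p = x ^ p + y ^ p + of_nat p * c"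
proof -
  have p: "p > 0" using assms prime_gt_0_nat by blast
  define f where "f = (\<lambda>k. of_nat (p choose k) * x ^ k * y ^ (p - k))"
  have "(x + y) ^ p = sum f {..p}" by (simp add: binomial_ring f_def)
  also have "{..p} = insert 0 (insert p {0<..<p})" using p by auto
  also have "sum f \<dots> = f 0 + (f p + sum f {0<..<p})" using p by simp
  finally have *: "(x + y) ^ p = x ^ p + y ^ p + sum f {0<..<p}" by (simp add: f_def)
  have "of_nat p dvd sum f {0<..<p}"
  proof (rule dvd_sum)
    fix k assume "k \<in> {0<..<p}"
    then have "p dvd p choose k" using assms by (intro dvd_choose_prime) auto
    then obtain c where "p choose k = p * c" by auto
    then show "of_nat p dvd f k" by (simp add: f_def mult.assoc)
  qed
  then obtain c where "sum f {0<..<p} = of_nat p * c" by (auto elim: dvdE)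
  with * show ?thesis by auto
qed

lemma frobenius_add:
  fixes x y :: "'a::comm_ring_1"
  assumes "prime p" "is_ideal I" "of_nat p \<in> I"
  shows "(x + y) ^ (p ^ j) - (x ^ (p ^ j) + y ^ (p ^ j)) \<in> I"
proof (induction j)
  case 0
  then show ?case using assms ideal_0 by simp
next
  case (Suc j)
  define u where "u = (x + y) ^ (p ^ j)"
  define v where "v = x ^ (p ^ j)"
  define w where "w = y ^ (p ^ j)"
  have "(u - (v + w)) dvd u ^ p - (v + w) ^ p"
    by (metis dvd_def power_diff_sumr2)
  moreover have "u - (v + w) \<in> I" using Suc by (simp add: u_def v_def w_def)
  ultimately have 1: "u ^ p - (v + w) ^ p \<in> I" using assms(2) ideal_dvd by blast
  obtain c where "(v + w) ^ p = v ^ p + w ^ p + of_nat p * c"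
    using prime_power_sum_expand[OF assms(1)] by blast
  then have "(v + w) ^ p - (v ^ p + w ^ p) \<in> I"
    using ideal_mult_right[OF assms(2,3)] by simp
  with 1 have "u ^ p - (v ^ p + w ^ p) \<in> I" using ideal_cong_trans[OF assms(2)] by blast
  then show ?case by (simp add: u_def v_def w_def power_mult[symmetric] mult.commute)
qed

lemma fermat_int:
  assumes "prime p"
  shows "int p dvd a ^ p - a"
proof (induction a rule: int_induct[where k = 0])
  case base
  then show ?case using prime_gt_0_nat[OF assms] by (simp add: power_0_left)
next
  case (step1 i)
  obtain c where "(i + 1) ^ p = i ^ p + 1 ^ p + of_nat p * c"
    using prime_power_sum_expand[OF assms] by blast
  then have eq: "(i + 1) ^ p - (i + 1) = (i ^ p - i) + int p * c" by simp
  show ?case unfolding eq by (rule dvd_add[OF step1(2) dvd_triv_left])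
next
  case (step2 i)
  obtain c where "(i - 1 + 1) ^ p = (i - 1) ^ p + 1 ^ p + of_nat p * c"
    using prime_power_sum_expand[OF assms] by blast
  then have eq: "(i - 1) ^ p - (i - 1) = (i ^ p - i) - int p * c" by simp
  show ?case unfolding eq by (rule dvd_diff[OF step2(2) dvd_triv_left])
qed

lemma of_int_power_prime_power_dvd:
  assumes "prime p"
  shows "int p dvd a ^ (p ^ j) - a"
proof (induction j)
  case (Suc j)
  have "[a ^ p ^ j = a] (mod int p)" using Suc by (simp add: cong_iff_dvd_diff)
  then have "[(a ^ p ^ j) ^ p = a ^ p] (mod int p)" by (rule cong_pow)
  moreover have "[a ^ p = a] (mod int p)"
    using fermat_int[OF assms] by (simp add: cong_iff_dvd_diff)
  ultimately have "[(a ^ p ^ j) ^ p = a] (mod int p)" using cong_trans by blast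
  then show ?case by (simp add: cong_iff_dvd_diff power_mult[symmetric] mult.commute)
qed simp

section \<open>Finite fields as quotients of integer polynomials\<close>

text \<open>The value is an eigenvalue of an integer circulant matrix, with eigenvector
  \<open>(1, z, \<dots>, z ^ (N - 1))\<close>.\<close>

lemma algebraic_int_poly_root_of_unity:
  fixes z :: complex and a :: "int poly"
  assumes z: "z ^ N = 1" and N: "N > 0"
  shows "algebraic_int (poly (map_poly of_int a) z)"
proof -
  \<comment> \<open>Row \<open>i\<close> lists the coefficients of \<open>a\<close> times
    \<open>X ^ i\<close> with exponents reduced modulo \<open>N\<close>; since
    \<open>z ^ N = 1\<close>, applying the matrix to the powers of \<open>z\<close> multiplies them
    by the value of \<open>a\<close> at \<open>z\<close>.\<close>
  define c where "c = (\<lambda>i j. \<Sum>n\<le>degree a. if (n + i) mod N = j then coeff a n else 0)"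
  define C where "C = mat N N (\<lambda>(i, j). c i j)"
  define v where "v = vec N (\<lambda>i. z ^ i)"
  define w where "w = poly (map_poly of_int a) z"
  have C: "C \<in> carrier_mat N N" by (simp add: C_def)
  let ?C = "map_mat of_int C :: complex mat"
  have zmod: "z ^ (n mod N) = z ^ n" for n
  proof -
    have "z ^ n = z ^ (N * (n div N) + n mod N)" by simp
    also have "\<dots> = z ^ (n mod N)" by (simp only: power_add power_mult z) simp
    finally show ?thesis by simp
  qed
  have "?C *\<^sub>v v = w \<cdot>\<^sub>v v"
  proof (rule eq_vecI)
    fix i assume "i < dim_vec (w \<cdot>\<^sub>v v)"
    then have i: "i < N" by (simp add: v_def)
    have "(?C *\<^sub>v v) $ i = (\<Sum>j<N. of_int (c i j) * z ^ j)"
      using i by (simp add: C_def v_def scalar_prod_def atLeast0LessThan)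
    also have "\<dots> = (\<Sum>j<N. \<Sum>n\<le>degree a. if (n + i) mod N = j then of_int (coeff a n) * z ^ j else 0)"
      unfolding c_def of_int_sum sum_distrib_right by (intro sum.cong) auto
    also have "\<dots> = (\<Sum>n\<le>degree a. \<Sum>j<N. if (n + i) mod N = j then of_int (coeff a n) * z ^ j else 0)"
      by (rule sum.swap)
    also have "\<dots> = (\<Sum>n\<le>degree a. of_int (coeff a n) * z ^ (n + i))"
      using N by (simp add: sum.delta zmod)
    also have "\<dots> = (\<Sum>n\<le>degree a. of_int (coeff a n) * z ^ n) * z ^ i"
      by (simp add: sum_distrib_right power_add mult.assoc)
    also have "(\<Sum>n\<le>degree a. of_int (coeff a n) * z ^ n) = w"
      by (simp add: w_def poly_altdef coeff_map_poly degree_map_poly)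
    finally show "(?C *\<^sub>v v) $ i = (w \<cdot>\<^sub>v v) $ i" using i by (simp add: v_def)
  qed (simp add: C_def v_def)
  moreover have "v \<noteq> 0\<^sub>v N"
  proof
    assume "v = 0\<^sub>v N"
    then have "v $ 0 = 0" using N by simp
    then show False using N by (simp add: v_def)
  qed
  moreover have "v \<in> carrier_vec N" by (simp add: v_def)
  ultimately have "eigenvalue ?C w"
    using C unfolding eigenvalue_def eigenvector_def by auto
  then have "poly (char_poly ?C) w = 0"
    using C by (subst eigenvalue_root_char_poly[symmetric]) auto
  then have "poly (map_poly of_int (char_poly C)) w = 0"
    using of_int_hom.char_poly_hom[OF C] by metis
  moreover have "lead_coeff (char_poly C) = 1" using degree_monic_char_poly[OF C] by simp
  ultimately show ?thesis unfolding algebraic_int_altdef_ipoly w_def by blast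
qed

text \<open>The ideal lies over the kernel of evaluation at a primitive \<open>N\<close>-th root of unity \<open>z\<close>; as
  \<open>N = (1 - z ^ i) * c\<close> with \<open>c\<close> in \<open>\<int>[z]\<close>, it cannot contain \<open>X ^ i - 1\<close> without containing \<open>N\<close>.\<close>

lemma ex_finite_field_ideal:
  fixes p N :: nat
  assumes p: "prime p" and N: "N > 0" and cop: "\<not> p dvd N"
  shows "\<exists>I :: int poly set. max_ideal I \<and> of_nat p \<in> I \<and> [:0, 1:] ^ N - 1 \<in> I \<and>
    (\<forall>i. 0 < i \<and> i < N \<longrightarrow> [:0, 1:] ^ i - 1 \<notin> I)"
proof -
  define z where "z = cis (2 * pi / N)"
  have zN: "z ^ N = 1" using N by (simp add: z_def DeMoivre)
  have z1: "z ^ i \<noteq> 1" if "0 < i" "i < N" for i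
  proof
    assume "z ^ i = 1"
    then have "cos (2 * pi * (i / N)) = 1"
      by (simp add: z_def DeMoivre complex_eq_iff algebra_simps)
    then obtain k :: int where "2 * pi * (i / N) = of_int k * 2 * pi"
      by (auto simp: cos_one_2pi_int)
    then have "(2 * pi) * (i / N) = (2 * pi) * of_int k" by (simp only: ac_simps)
    then have "i / N = of_int k" by (simp only: mult_cancel_left) simp
    then have "real_of_int (int i) = of_int (k * int N)" using N by (simp add: field_simps)
    then have "int i = k * int N" by (simp only: of_int_eq_iff)
    then have "int N dvd int i" by simp
    then show False using that by (auto dest: dvd_imp_le)
  qed
  define ev where "ev = (\<lambda>f :: int poly. poly (map_poly of_int f) z)"
  have ev_add: "ev (f + g) = ev f + ev g" for f g
    by (simp add: ev_def of_int_poly_hom.hom_add)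
  have ev_mult: "ev (f * g) = ev f * ev g" for f g
    by (simp add: ev_def of_int_poly_hom.hom_mult)
  \<comment> \<open>The ideal generated by \<open>p\<close> and the kernel of evaluation at
    \<open>z\<close>.\<close>
  define J where "J = {of_nat p * a + b | a b. ev b = 0}"
  have "is_ideal J"
    unfolding is_ideal_def
  proof (intro conjI ballI allI)
    have "0 = of_nat p * 0 + (0 :: int poly) \<and> ev 0 = 0" by (simp add: ev_def)
    then show "0 \<in> J" unfolding J_def by blast
    fix f assume "f \<in> J"
    then obtain a b where f: "f = of_nat p * a + b" "ev b = 0" by (auto simp: J_def)
    show "r * f \<in> J" for r
    proof -
      have "r * f = of_nat p * (r * a) + r * b" by (simp add: f algebra_simps)
      moreover have "ev (r * b) = 0" by (simp add: f ev_mult)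
      ultimately show ?thesis unfolding J_def by blast
    qed
    fix g assume "g \<in> J"
    then obtain a' b' where g: "g = of_nat p * a' + b'" "ev b' = 0" by (auto simp: J_def)
    have "f + g = of_nat p * (a + a') + (b + b')" by (simp add: f g algebra_simps)
    moreover have "ev (b + b') = 0" by (simp add: f g ev_add)
    ultimately show "f + g \<in> J" unfolding J_def by blast
  qed
  moreover have "1 \<notin> J"
  proof
    assume "1 \<in> J"
    then obtain a b where ab: "1 = of_nat p * a + b" "ev b = 0" by (auto simp: J_def)
    have "1 = ev 1" by (simp add: ev_def)
    also have "\<dots> = ev (of_nat p) * ev a" using ab by (metis ev_add ev_mult add.right_neutral)
    also have "ev (of_nat p) = of_nat p"
      by (simp add: ev_def of_nat_poly of_int_hom.map_poly_pCons_hom)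
    finally have e1: "1 = of_nat p * ev a" .
    \<comment> \<open>The relation would make 1/p an algebraic integer; rational algebraic integers
      are integers, and \<open>p\<close> is not a unit there.\<close>
    then have "ev a = of_rat (1 / of_nat p)"
      using prime_gt_0_nat[OF p] by (simp add: field_simps of_rat_divide)
    moreover have "algebraic_int (ev a)"
      unfolding ev_def by (rule algebraic_int_poly_root_of_unity[OF zN N])
    ultimately have "ev a \<in> \<int>"
      by (intro rational_algebraic_int_is_int) auto
    then obtain k where "ev a = of_int k" by (auto elim: Ints_cases)
    then have "of_int (int p * k) = (1 :: complex)"
      using e1 by simp
    then have "int p * k = 1" by (simp only: of_int_eq_1_iff)
    then have "int p dvd 1" by (metis dvd_triv_left)
    then show False using prime_gt_1_nat[OF p] by simp
  qed
  ultimately obtain I where I: "J \<subseteq> I" "max_ideal I" using ex_max_ideal by blast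
  have id: "is_ideal I" and I1: "1 \<notin> I" using I by (auto simp: max_ideal_def)
  have ker: "f \<in> I" if "ev f = 0" for f
  proof -
    have "f = of_nat p * 0 + f" by simp
    then show ?thesis using that I unfolding J_def by blast
  qed
  have pI: "of_nat p \<in> I"
  proof -
    have "of_nat p = of_nat p * (1 :: int poly) + 0" "ev 0 = 0" by (auto simp: ev_def)
    then have "of_nat p \<in> J" unfolding J_def by blast
    then show ?thesis using I by blast
  qed
  have ev1: "ev 1 = 1" and evX: "ev [:0, 1:] = z"
    by (simp_all add: ev_def of_int_hom.map_poly_pCons_hom)
  have ev_pow: "ev ([:0, 1:] ^ i) = z ^ i" for i
    by (induction i) (simp_all only: power_0 power_Suc ev1 evX ev_mult)
  have evm1: "ev (-1) = -1" by (simp add: ev_def of_int_poly_hom.hom_uminus)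
  have "[:0, 1:] ^ N - 1 \<in> I"
    using ev_add[of "[:0, 1:] ^ N" "-1"] by (intro ker) (simp add: ev_pow evm1 zN)
  moreover have "[:0, 1:] ^ i - 1 \<notin> I" if i: "0 < i" "i < N" for i
  proof
    assume *: "[:0, 1:] ^ i - 1 \<in> I"
    define X where "X = ([:0, 1:] :: int poly)"
    \<comment> \<open>Evaluation sends \<open>S\<close> to a geometric sum that vanishes, as
      \<open>z ^ i\<close> is an \<open>N\<close>-th root of unity other than 1; so \<open>S\<close>
      lies in \<open>I\<close>. If \<open>X ^ i\<close> were congruent to 1, \<open>S\<close> would
      also be congruent to \<open>N\<close>, which is coprime to \<open>p\<close>.\<close>
    define S where "S = (\<Sum>j<N. (X ^ i) ^ j)"
    have evS: "ev S = (\<Sum>j<N. (z ^ i) ^ j)"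
    proof -
      have "ev (\<Sum>j<n. X ^ (i * j)) = (\<Sum>j<n. z ^ (i * j))" for n
        by (induction n) (simp_all only: sum.lessThan_Suc ev_add ev_pow X_def, simp add: ev_def)
      then show ?thesis unfolding S_def power_mult[symmetric] .
    qed
    have "(z ^ i) ^ N = 1" by (metis power_commutes power_mult mult.commute power_one zN)
    then have "(z ^ i - 1) * ev S = 0" unfolding evS power_diff_1_eq[symmetric] by simp
    then have "S \<in> I" using z1[OF i] by (intro ker) auto
    moreover have "of_nat N - S \<in> I"
    proof -
      have "of_nat N - S = (\<Sum>j<N. 1 - (X ^ i) ^ j)" by (simp add: S_def sum_subtractf)
      also have "\<dots> \<in> I"
      proof (rule ideal_sum[OF id])
        fix j
        have "(X ^ i) ^ j - 1 = (X ^ i - 1) * (\<Sum>l<j. (X ^ i) ^ l)" by (rule power_diff_1_eq)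
        then have "(X ^ i) ^ j - 1 \<in> I" using * ideal_mult_right[OF id] by (simp add: X_def)
        then show "1 - (X ^ i) ^ j \<in> I" by (rule ideal_cong_sym[OF id])
      qed
      finally show ?thesis .
    qed
    ultimately have "of_nat N \<in> I" using ideal_add[OF id] by fastforce
    moreover have "coprime (int p) (int N)"
      using p cop by (simp add: prime_imp_coprime)
    then obtain u v where "u * int p + v * int N = 1" by (metis bezout_int coprime_iff_gcd_eq_1)
    then have "of_int (u * int p + v * int N) = (1 :: int poly)" by simp
    then have "of_int u * of_nat p + of_int v * of_nat N = (1 :: int poly)" by simp
    ultimately show False using I1 pI ideal_add[OF id] ideal_mult[OF id] by metis
  qed
  ultimately show ?thesis using I(2) pI by blast
qed

text \<open>Representatives of the vectors over the field with \<open>p\<close> elements.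
  Extensionality makes them unique, so that sums over this set count every vector once.\<close>

abbreviation box :: "nat \<Rightarrow> nat \<Rightarrow> (nat \<Rightarrow> int) set" where
  "box p k \<equiv> {..<k} \<rightarrow>\<^sub>E {0..<int p}"

text \<open>The quotient by \<open>I\<close> is the field with \<open>p ^ k\<close> elements and
  \<open>X\<close> generates its multiplicative group. The size is not assumed;
  \<open>ex_basis\<close> derives it from the exact order of \<open>X\<close>.\<close>

locale finite_field_ideal =
  fixes p k :: nat and I :: "int poly set" and X :: "int poly"
  defines "X \<equiv> [:0, 1:]"
  assumes p: "prime p" and k: "k > 0"
    and max: "max_ideal I" and pI: "of_nat p \<in> I"
    and X_order: "X ^ (p ^ k - 1) - 1 \<in> I"
      "\<And>i. 0 < i \<Longrightarrow> i < p ^ k - 1 \<Longrightarrow> X ^ i - 1 \<notin> I"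
begin

lemma ideal_I: "is_ideal I" and one_notin: "1 \<notin> I"
  using max by (auto simp: max_ideal_def)

lemma X_power: "X ^ n = monom 1 n"
  by (simp add: X_def monom_altdef)

lemma p_gt: "p > 1" using p prime_gt_1_nat by blast

lemma q_gt: "p ^ k > 1" by (rule one_less_power[OF p_gt k])

lemma const_mem: "[:a:] \<in> I \<longleftrightarrow> int p dvd a"
proof
  assume "int p dvd a"
  then obtain c where "a = int p * c" by auto
  then have "[:a:] = of_nat p * [:c:]" by (simp add: of_nat_poly)
  then show "[:a:] \<in> I" using ideal_mult_right[OF ideal_I pI] by metis
next
  assume a: "[:a:] \<in> I"
  show "int p dvd a"
  proof (rule ccontr)
    assume "\<not> int p dvd a"
    then have "coprime (int p) a" using p by (simp add: prime_imp_coprime)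
    then obtain u v where "u * int p + v * a = 1" by (metis bezout_int coprime_iff_gcd_eq_1)
    then have "[:u:] * of_nat p + [:v:] * [:a:] = (1 :: int poly)"
      by (simp add: of_nat_poly one_pCons mult.commute)
    then show False using one_notin a pI ideal_add[OF ideal_I] ideal_mult[OF ideal_I] by metis
  qed
qed

lemma dvd_coeffs_mem: "(\<And>i. int p dvd coeff f i) \<Longrightarrow> f \<in> I"
proof (induction f)
  case 0
  then show ?case by (simp add: ideal_0 ideal_I)
next
  case (pCons a f)
  have "int p dvd a" using pCons(3)[of 0] by simp
  moreover have "f \<in> I" using pCons(2) pCons(3)[of "Suc _"] by simp
  moreover have "pCons a f = [:a:] + X * f" by (simp add: X_def)
  ultimately show ?case using const_mem ideal_add[OF ideal_I] ideal_mult[OF ideal_I] by metis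
qed

text \<open>Raising to the power \<open>p ^ k\<close> is additive modulo \<open>I\<close>, fixes
  constants by Fermat, and fixes \<open>X\<close> because of its order; induction over the
  coefficients does the rest. All elements of the quotient are thus roots of one polynomial of
  degree \<open>p ^ k\<close>, which bounds their number.\<close>

lemma frobenius_fixed: "f ^ (p ^ k) - f \<in> I"
proof (induction f)
  case 0
  then show ?case using p_gt by (simp add: ideal_0 ideal_I power_0_left)
next
  case (pCons a f)
  define q where "q = p ^ k"
  have eq: "pCons a f = [:a:] + X * f" by (simp add: X_def)
  have 1: "([:a:] + X * f) ^ q - ([:a:] ^ q + (X * f) ^ q) \<in> I"
    unfolding q_def by (rule frobenius_add[OF p ideal_I pI])
  have 2: "[:a:] ^ q - [:a:] \<in> I"
  proof -
    have "[:a:] ^ q = [:a ^ q:]" by (induction q) (auto simp: one_pCons)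
    then have "[:a:] ^ q - [:a:] = [:a ^ q - a:]" by simp
    then show ?thesis using of_int_power_prime_power_dvd[OF p] const_mem by (simp add: q_def)
  qed
  have X: "X ^ q - X \<in> I"
  proof -
    have "q = Suc (q - 1)" using q_gt by (simp add: q_def)
    then have "X ^ q = X * X ^ (q - 1)" by (metis power_Suc)
    then have "X ^ q - X = X * (X ^ (q - 1) - 1)" by (simp add: algebra_simps)
    then show ?thesis using X_order(1) ideal_mult[OF ideal_I] by (simp add: q_def)
  qed
  have f: "f ^ q - f \<in> I" using pCons(2) by (simp add: q_def)
  have "(X * f) ^ q - X * f = f ^ q * (X ^ q - X) + X * (f ^ q - f)"
    by (simp add: algebra_simps power_mult_distrib)
  then have 3: "(X * f) ^ q - X * f \<in> I" using X f ideal_add[OF ideal_I] ideal_mult[OF ideal_I] by metis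
  have "([:a:] + X * f) ^ q - ([:a:] + X * f) =
     (([:a:] + X * f) ^ q - ([:a:] ^ q + (X * f) ^ q)) + (([:a:] ^ q - [:a:]) + ((X * f) ^ q - X * f))"
    by simp
  also have "\<dots> \<in> I" using 1 2 3 ideal_add[OF ideal_I] by blast
  finally show ?case by (simp only: eq q_def)
qed

text \<open>Degree below \<open>d\<close>, said through coefficients so that the zero polynomial and
  \<open>d = 0\<close> are no exceptions.\<close>

definition lowdeg :: "nat \<Rightarrow> int poly \<Rightarrow> bool" where
  "lowdeg d f \<longleftrightarrow> (\<forall>i\<ge>d. coeff f i = 0)"

text \<open>The powers \<open>X ^ i\<close> with \<open>i < d\<close> form a basis of the quotient
  over the prime field, where \<open>d\<close> is the degree of the minimal polynomial of
  \<open>X\<close>. It is found as the least position of a top coefficient not divisible by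
  \<open>p\<close> in an element of \<open>I\<close>.\<close>

lemma ex_power_basis:
  "\<exists>d. (\<forall>f. lowdeg d f \<longrightarrow> f \<in> I \<longrightarrow> (\<forall>i. int p dvd coeff f i)) \<and>
       (\<forall>f. \<exists>g. lowdeg d g \<and> f - g \<in> I)"
proof -
  define P where "P = (\<lambda>d. \<exists>f. f \<in> I \<and> lowdeg (Suc d) f \<and> \<not> int p dvd coeff f d)"
  have "P (p ^ k - 1)"
  proof -
    have "X ^ n - 1 = monom 1 n - monom 1 0" for n by (simp add: X_power)
    then show ?thesis using X_order(1) q_gt p_gt unfolding P_def
      by (intro exI[of _ "X ^ (p ^ k - 1) - 1"]) (auto simp: lowdeg_def)
  qed
  then have "\<exists>d. P d" by blast
  define d where "d = (LEAST d. P d)"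
  have Pd: "P d" unfolding d_def using \<open>\<exists>d. P d\<close> by (rule LeastI_ex)
  have least: "\<not> P e" if "e < d" for e using that not_less_Least unfolding d_def by blast
  have indep: "int p dvd coeff f i" if "lowdeg d f" "f \<in> I" for f i
  proof (rule ccontr)
    assume i: "\<not> int p dvd coeff f i"
    define S where "S = {i. \<not> int p dvd coeff f i}"
    have S: "S \<subseteq> {..<d}" using that by (auto simp: S_def lowdeg_def not_le[symmetric])
    then have fin: "finite S" using finite_subset by blast
    define e where "e = Max S"
    have e: "e \<in> S" using i fin unfolding e_def by (intro Max_in) (auto simp: S_def)
    \<comment> \<open>Truncating \<open>f\<close> after its last coefficient not divisible by
      \<open>p\<close> changes it only by an element of \<open>I\<close>; the truncation contradicts
      the minimality of \<open>d\<close>.\<close>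
    define g where "g = (\<Sum>i\<le>e. monom (coeff f i) i)"
    have cg: "coeff g i = (if i \<le> e then coeff f i else 0)" for i
      by (simp add: g_def coeff_sum)
    have "int p dvd coeff (f - g) j" for j
    proof (cases "j \<le> e")
      case False
      then have "j \<notin> S" using Max_ge[OF fin, of j] by (auto simp: e_def)
      then show ?thesis using False by (simp add: cg S_def)
    qed (simp add: cg)
    then have "f - g \<in> I" by (rule dvd_coeffs_mem)
    then have "g \<in> I" using ideal_diff[OF ideal_I that(2)] by fastforce
    then have "P e" unfolding P_def using e by (intro exI[of _ g]) (auto simp: cg lowdeg_def S_def)
    then show False using least e S by auto
  qed
  from Pd obtain f where f: "f \<in> I" "lowdeg (Suc d) f" "\<not> int p dvd coeff f d"
    by (auto simp: P_def)
  then have "coprime (int p) (coeff f d)" using p by (simp add: prime_imp_coprime)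
  then obtain u v where uv: "u * int p + v * coeff f d = 1" by (metis bezout_int coprime_iff_gcd_eq_1)
  \<comment> \<open>Multiplying by the inverse \<open>v\<close> of the top coefficient modulo
    \<open>p\<close> and adding a multiple of \<open>p\<close> makes the coefficient at
    \<open>d\<close> exactly 1, so that division with remainder works over the integers.\<close>
  define \<mu> where "\<mu> = [:v:] * f + monom (u * int p) d"
  have "monom (u * int p) d \<in> I" by (rule dvd_coeffs_mem) simp
  then have \<mu>: "\<mu> \<in> I" unfolding \<mu>_def using f(1) by (intro ideal_add[OF ideal_I] ideal_mult[OF ideal_I])
  have \<mu>d: "coeff \<mu> d = 1" using uv by (simp add: \<mu>_def)
  have \<mu>low: "lowdeg (Suc d) \<mu>" using f by (auto simp: \<mu>_def lowdeg_def)
  have span: "\<exists>g. lowdeg d g \<and> h - g \<in> I" for h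
  proof (induction h)
    case 0
    then show ?case by (intro exI[of _ 0]) (auto simp: lowdeg_def ideal_0 ideal_I)
  next
    case (pCons a h)
    then obtain g where g: "lowdeg d g" "h - g \<in> I" by blast
    \<comment> \<open>One step of division by \<mu>: a term of degree \<open>d\<close> in
      \<open>pCons a g\<close> is cleared by subtracting a multiple of \<mu>.\<close>
    define g' where "g' = pCons a g - [:coeff (pCons a g) d:] * \<mu>"
    have "lowdeg d g'"
      unfolding lowdeg_def
    proof (intro allI impI)
      fix i assume "d \<le> i"
      then consider "i = d" | "Suc d \<le> i" by linarith
      then show "coeff g' i = 0"
      proof cases
        case 1
        then show ?thesis by (simp add: g'_def \<mu>d)
      next
        case 2
        then show ?thesis using \<mu>low g
          by (auto simp: g'_def lowdeg_def coeff_pCons split: nat.split)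
      qed
    qed
    moreover have "pCons a h - g' = X * (h - g) + [:coeff (pCons a g) d:] * \<mu>"
      by (simp add: g'_def X_def)
    then have "pCons a h - g' \<in> I" using g \<mu> ideal_add[OF ideal_I] ideal_mult[OF ideal_I] by metis
    ultimately show ?case by blast
  qed
  show ?thesis using indep span by blast
qed

section \<open>Canonical representatives and their number\<close>

definition reduced :: "nat \<Rightarrow> int poly set" where
  "reduced d = {f. lowdeg d f \<and> (\<forall>i. 0 \<le> coeff f i \<and> coeff f i < int p)}"

definition box_poly :: "nat \<Rightarrow> (nat \<Rightarrow> int) \<Rightarrow> int poly" where
  "box_poly d x = (\<Sum>l<d. monom (x l) l)"

lemma coeff_box_poly: "coeff (box_poly d x) i = (if i < d then x i else 0)"
  by (simp add: box_poly_def coeff_sum)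

lemma lowdeg_box_poly: "lowdeg d (box_poly d x)"
  by (simp add: lowdeg_def coeff_box_poly)

lemma lowdeg_eq_box_poly: "lowdeg d f \<Longrightarrow> f = box_poly d (coeff f)"
  by (rule poly_eqI) (auto simp: lowdeg_def coeff_box_poly)

lemma reduced_eq_image: "reduced d = box_poly d ` (box p d)"
proof safe
  fix f assume f: "f \<in> reduced d"
  then have "f = box_poly d (restrict (coeff f) {..<d})"
    by (intro poly_eqI) (auto simp: reduced_def lowdeg_def coeff_box_poly)
  moreover have "restrict (coeff f) {..<d} \<in> box p d"
    using f by (auto simp: reduced_def)
  ultimately show "f \<in> box_poly d ` (box p d)" by blast
next
  fix x assume "x \<in> box p d"
  then show "box_poly d x \<in> reduced d"
    using p_gt by (auto simp: reduced_def lowdeg_box_poly coeff_box_poly PiE_iff)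
qed

lemma card_reduced: "card (reduced d) = p ^ d" and finite_reduced: "finite (reduced d)"
proof -
  have "inj_on (box_poly d) (box p d)"
  proof (rule inj_onI)
    fix x y assume x: "x \<in> box p d" and y: "y \<in> box p d"
      and eq: "box_poly d x = box_poly d y"
    have "x i = y i" if "i < d" for i
      using arg_cong[OF eq, of "\<lambda>f. coeff f i"] that by (simp add: coeff_box_poly)
    then show "x = y" using x y by (intro PiE_ext) auto
  qed
  then show "card (reduced d) = p ^ d" by (simp add: reduced_eq_image card_image card_PiE)
  show "finite (reduced d)" by (simp add: reduced_eq_image finite_PiE)
qed

lemma ex_reduced:
  assumes "\<And>f. \<exists>g. lowdeg d g \<and> f - g \<in> I"
  shows "\<exists>g\<in>reduced d. f - g \<in> I"
proof -
  obtain g where g: "lowdeg d g" "f - g \<in> I" using assms by blast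
  define h where "h = box_poly d (\<lambda>i. coeff g i mod int p)"
  have "h \<in> reduced d"
    using p_gt by (auto simp: reduced_def h_def lowdeg_box_poly coeff_box_poly)
  moreover have "g - h \<in> I"
  proof (rule dvd_coeffs_mem)
    show "int p dvd coeff (g - h) i" for i
      using g by (auto simp: h_def coeff_box_poly lowdeg_def)
  qed
  ultimately show ?thesis using g ideal_cong_trans[OF ideal_I] by blast
qed

lemma reduced_eqI:
  assumes indep: "\<And>f. lowdeg d f \<Longrightarrow> f \<in> I \<Longrightarrow> (\<forall>i. int p dvd coeff f i)"
    and "f \<in> reduced d" "g \<in> reduced d" "f - g \<in> I"
  shows "f = g"
proof (rule poly_eqI)
  fix i
  have "lowdeg d (f - g)" using assms by (auto simp: reduced_def lowdeg_def)
  then have "int p dvd coeff f i - coeff g i" using indep assms(4) by fastforce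
  then have "coeff f i mod int p = coeff g i mod int p" by (simp add: mod_eq_dvd_iff)
  then show "coeff f i = coeff g i" using assms(2,3) by (simp add: reduced_def)
qed

section \<open>Powers of \<open>X\<close> and the size of the field\<close>

lemma X_unit: "X ^ i * X ^ ((p ^ k - 1) * i - i) - 1 \<in> I"
proof -
  let ?N = "p ^ k - 1"
  have "1 * i \<le> ?N * i" using q_gt by (intro mult_le_mono1) simp
  then have "X ^ i * X ^ (?N * i - i) = (X ^ ?N) ^ i"
    by (simp add: power_add[symmetric] power_mult[symmetric])
  moreover have "X ^ ?N - 1 dvd (X ^ ?N) ^ i - 1" by (simp add: power_diff_1_eq)
  ultimately show ?thesis using X_order(1) ideal_dvd[OF ideal_I] by metis
qed

lemma X_pow_notin: "X ^ i \<notin> I"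
proof
  assume "X ^ i \<in> I"
  then have "X ^ i * X ^ ((p ^ k - 1) * i - i) - (X ^ i * X ^ ((p ^ k - 1) * i - i) - 1) \<in> I"
    using X_unit ideal_mult_right[OF ideal_I] ideal_diff[OF ideal_I] by blast
  then show False using one_notin by simp
qed

lemma X_pow_inj:
  assumes "i < j" "j < p ^ k - 1"
  shows "X ^ j - X ^ i \<notin> I"
proof
  assume "X ^ j - X ^ i \<in> I"
  moreover have "X ^ j - X ^ i = X ^ i * (X ^ (j - i) - 1)"
    using assms by (simp add: algebra_simps power_add[symmetric])
  ultimately have "X ^ (j - i) - 1 \<in> I" using max_ideal_prime[OF max] X_pow_notin by metis
  then show False using X_order(2)[of "j - i"] assms by auto
qed

text \<open>Counting shows \<open>d = k\<close> for the basis of \<open>ex_power_basis\<close>. The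
  \<open>p ^ d\<close> reduced polynomials are incongruent roots of \<open>Y ^ (p ^ k) - Y\<close>,
  so \<open>d\<close> is at most \<open>k\<close>. Conversely, 0 and the \<open>p ^ k - 1\<close>
  powers of \<open>X\<close> are incongruent and have distinct reduced representatives.\<close>

lemma ex_basis:
  "(\<forall>f. lowdeg k f \<longrightarrow> f \<in> I \<longrightarrow> (\<forall>i. int p dvd coeff f i)) \<and> (\<forall>f. \<exists>g. lowdeg k g \<and> f - g \<in> I)"
proof -
  obtain d where indep: "\<And>f. lowdeg d f \<Longrightarrow> f \<in> I \<Longrightarrow> (\<forall>i. int p dvd coeff f i)"
    and span: "\<And>f. \<exists>g. lowdeg d g \<and> f - g \<in> I"
    using ex_power_basis by blast
  let ?N = "p ^ k - 1"
  have "p ^ d \<le> p ^ k"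
  proof -
    let ?g = "monom 1 (p ^ k) - monom 1 1 :: int poly poly"
    have dg: "degree ?g = p ^ k"
    proof (rule antisym)
      show "degree ?g \<le> p ^ k" using q_gt by (intro degree_le) auto
      show "p ^ k \<le> degree ?g" using q_gt by (intro le_degree) auto
    qed
    have "card (reduced d) \<le> degree ?g"
    proof (rule card_roots_mod_max_ideal[OF max])
      show "lead_coeff ?g = 1" unfolding dg using q_gt by simp
      show "finite (reduced d)" by (rule finite_reduced)
      show "poly ?g x \<in> I" for x using frobenius_fixed by (simp add: poly_monom)
    qed (use reduced_eqI indep in blast)
    then show ?thesis by (simp only: dg card_reduced)
  qed
  moreover have "p ^ k \<le> p ^ d"
  proof -
    define S where "S = insert 0 ((\<lambda>i. X ^ i) ` {..<?N})"
    define r where "r = (\<lambda>f. SOME g. g \<in> reduced d \<and> f - g \<in> I)"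
    have r: "r f \<in> reduced d \<and> f - r f \<in> I" for f
    proof -
      have "\<exists>g. g \<in> reduced d \<and> f - g \<in> I" using ex_reduced[OF span, of f] by blast
      then show ?thesis unfolding r_def by (rule someI_ex)
    qed
    have S: "x = y" if "x \<in> S" "y \<in> S" "x - y \<in> I" for x y
    proof -
      have "i = j" if "X ^ i - X ^ j \<in> I" "i < ?N" "j < ?N" for i j
        using X_pow_inj[of i j] X_pow_inj[of j i] that ideal_cong_sym[OF ideal_I] by (metis linorder_neqE_nat)
      moreover have "0 - X ^ i \<notin> I" for i
        using X_pow_notin[of i] ideal_uminus[OF ideal_I, of "- (X ^ i)"] by auto
      ultimately show ?thesis using that X_pow_notin by (auto simp: S_def)
    qed
    have "inj_on r S"
    proof (rule inj_onI)
      fix x y assume xy: "x \<in> S" "y \<in> S" "r x = r y"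
      then have "x - y \<in> I" using r[of x] r[of y] ideal_cong_trans[OF ideal_I] ideal_cong_sym[OF ideal_I] by metis
      then show "x = y" using S xy by blast
    qed
    then have "card S \<le> card (reduced d)"
      using r by (intro card_inj_on_le[OF _ _ finite_reduced]) auto
    moreover have "card S = Suc ?N"
    proof -
      have "inj_on (\<lambda>i. X ^ i) {..<?N}"
      proof (rule inj_onI)
        fix i j assume "i \<in> {..<?N}" "j \<in> {..<?N}" "X ^ i = X ^ j"
        then have "degree (X ^ i) = degree (X ^ j)" by simp
        then show "i = j" by (simp add: X_power degree_monom_eq)
      qed
      moreover have "0 \<notin> (\<lambda>i. X ^ i) ` {..<?N}" by (auto simp: X_power)
      ultimately show ?thesis by (simp add: S_def card_image)
    qed
    ultimately show ?thesis using q_gt by (simp add: card_reduced)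
  qed
  ultimately have "p ^ d = p ^ k" by (rule antisym)
  then have "d = k" using power_inject_exp[OF p_gt] by blast
  show ?thesis using indep span unfolding \<open>d = k\<close> by simp
qed

text \<open>Since \<open>SOME\<close> picks the representative, this is well defined only modulo \<open>p\<close>.\<close>

definition coord0 :: "int poly \<Rightarrow> int" where
  "coord0 f = coeff (SOME g. lowdeg k g \<and> f - g \<in> I) 0"

lemma coord0_cong:
  assumes "lowdeg k g" "f - g \<in> I"
  shows "int p dvd coord0 f - coeff g 0"
proof -
  define h where "h = (SOME g. lowdeg k g \<and> f - g \<in> I)"
  have h: "lowdeg k h \<and> f - h \<in> I" unfolding h_def by (rule someI_ex) (use ex_basis in blast)
  then have "h - g \<in> I" using assms ideal_cong_trans[OF ideal_I] ideal_cong_sym[OF ideal_I] by metis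
  moreover have "lowdeg k (h - g)" using h assms by (simp add: lowdeg_def)
  ultimately have "int p dvd coeff (h - g) 0" using ex_basis by blast
  then show ?thesis by (simp add: coord0_def h_def)
qed

lemma coord0_I: "f \<in> I \<Longrightarrow> int p dvd coord0 f"
  using coord0_cong[of 0 f] by (simp add: lowdeg_def)

lemma coord0_lincomb: "int p dvd coord0 (f + [:c:] * g) - (coord0 f + c * coord0 g)"
proof -
  obtain f' g' where f': "lowdeg k f'" "f - f' \<in> I" and g': "lowdeg k g'" "g - g' \<in> I"
    using ex_basis by meson
  have "(f + [:c:] * g) - (f' + [:c:] * g') = (f - f') + [:c:] * (g - g')"
    by (simp add: algebra_simps smult_diff_right)
  also have "\<dots> \<in> I" using f' g' ideal_add[OF ideal_I] ideal_mult[OF ideal_I] by blast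
  finally have "int p dvd coord0 (f + [:c:] * g) - coeff (f' + [:c:] * g') 0"
    using f' g' by (intro coord0_cong) (auto simp: lowdeg_def)
  moreover have "int p dvd (coord0 f - coeff f' 0) + c * (coord0 g - coeff g' 0)"
    using coord0_cong[OF f'] coord0_cong[OF g'] by (intro dvd_add dvd_mult)
  ultimately have "int p dvd (coord0 (f + [:c:] * g) - coeff (f' + [:c:] * g') 0) -
      ((coord0 f - coeff f' 0) + c * (coord0 g - coeff g' 0))" by (rule dvd_diff)
  then show ?thesis by (simp add: algebra_simps)
qed

lemma coord0_sum:
  "finite A \<Longrightarrow> int p dvd coord0 (\<Sum>i\<in>A. [:c i:] * g i) - (\<Sum>i\<in>A. c i * coord0 (g i))"
proof (induction A rule: finite_induct)
  case empty
  then show ?case using coord0_I ideal_0[OF ideal_I] by simp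
next
  case (insert a A)
  let ?s = "\<Sum>i\<in>A. [:c i:] * g i"
  have "int p dvd (coord0 (?s + [:c a:] * g a) - (coord0 ?s + c a * coord0 (g a)))
     + (coord0 ?s - (\<Sum>i\<in>A. c i * coord0 (g i)))"
    using insert coord0_lincomb by (intro dvd_add)
  then show ?case using insert by (simp add: algebra_simps)
qed

text \<open>An element outside \<open>I\<close> has an inverse modulo \<open>I\<close>, which can be
  expanded in the power basis. The hypotheses would then force the functional to vanish at 1 modulo
  \<open>p\<close>, whereas the constant coordinate of 1 is 1.\<close>

lemma coord0_nondegenerate:
  assumes "\<And>i. i < k \<Longrightarrow> int p dvd coord0 (f * X ^ i)"
  shows "f \<in> I"
proof (rule ccontr)
  assume "f \<notin> I"
  then obtain y where y: "f * y - 1 \<in> I" using max by (auto simp: max_ideal_def)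
  obtain g where g: "lowdeg k g" "y - g \<in> I" using ex_basis by blast
  have "f * g - 1 = (f * y - 1) - f * (y - g)" by (simp add: algebra_simps)
  then have 1: "f * g - 1 \<in> I" using y g ideal_diff[OF ideal_I] ideal_mult[OF ideal_I] by metis
  have "lowdeg k 1" using k by (auto simp: lowdeg_def)
  from coord0_cong[OF this 1] have c1: "int p dvd coord0 (f * g) - 1" by simp
  have "g = (\<Sum>i<k. [:coeff g i:] * X ^ i)"
    by (subst lowdeg_eq_box_poly[OF g(1)]) (simp add: box_poly_def X_def monom_altdef)
  then have "f * g = f * (\<Sum>i<k. [:coeff g i:] * X ^ i)" by (rule arg_cong)
  also have "\<dots> = (\<Sum>i<k. [:coeff g i:] * (f * X ^ i))"
    by (simp add: sum_distrib_left)
  finally have "int p dvd coord0 (f * g) - (\<Sum>i<k. coeff g i * coord0 (f * X ^ i))"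
    using coord0_sum[of "{..<k}" "coeff g" "\<lambda>i. f * X ^ i"] by simp
  moreover have "int p dvd (\<Sum>i<k. coeff g i * coord0 (f * X ^ i))"
    using assms by (intro dvd_sum) auto
  ultimately have "int p dvd coord0 (f * g)" by (metis diff_add_cancel dvd_add)
  then have "int p dvd coord0 (f * g) - (coord0 (f * g) - 1)" using c1 by (rule dvd_diff)
  then show False using p_gt by simp
qed

end

text \<open>The matrices of the forms \<open>(x, y) \<mapsto> T (a x y)\<close> on the field with \<open>p ^ k\<close> elements,
  where \<open>T\<close> is a nonzero functional to the prime field.\<close>

lemma ex_symmetric_matrix_family:
  fixes p k :: nat
  assumes p: "prime p" and k: "k > 0"
  shows "\<exists>M :: (nat \<Rightarrow> int) \<Rightarrow> nat \<Rightarrow> nat \<Rightarrow> int. (\<forall>a i j. M a i j = M a j i) \<and>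
    (\<forall>a\<in>box p k. \<forall>b\<in>box p k. a \<noteq> b \<longrightarrow>
      (\<forall>h. (\<forall>i<k. int p dvd (\<Sum>j<k. (M a i j - M b i j) * h j)) \<longrightarrow> (\<forall>j<k. int p dvd h j)))"
proof -
  have p1: "p > 1" using p prime_gt_1_nat by blast
  have q: "p ^ k > 1" by (rule one_less_power[OF p1 k])
  have "\<not> p dvd p ^ k - 1"
  proof
    assume "p dvd p ^ k - 1"
    moreover have "p dvd p ^ k" using k by simp
    ultimately have "p dvd p ^ k - (p ^ k - 1)" using dvd_diff_nat by blast
    then show False using q p1 by simp
  qed
  moreover have "p ^ k - 1 > 0" using q by simp
  ultimately have "\<exists>I :: int poly set. max_ideal I \<and> of_nat p \<in> I \<and> [:0, 1:] ^ (p ^ k - 1) - 1 \<in> I \<and>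
    (\<forall>i. 0 < i \<and> i < p ^ k - 1 \<longrightarrow> [:0, 1:] ^ i - 1 \<notin> I)"
    by (intro ex_finite_field_ideal[OF p])
  then obtain I :: "int poly set" where I: "max_ideal I" "of_nat p \<in> I" "[:0, 1:] ^ (p ^ k - 1) - 1 \<in> I"
      "\<forall>i. 0 < i \<and> i < p ^ k - 1 \<longrightarrow> [:0, 1:] ^ i - 1 \<notin> I"
    by (elim exE conjE) (rule that)
  interpret finite_field_ideal p k I "[:0, 1:]"
    by unfold_locales (use I p k in auto)
  let ?X = "[:0, 1:] :: int poly"
  define M where "M = (\<lambda>a i j. coord0 (box_poly k a * ?X ^ (i + j)))"
  have "\<forall>j<k. int p dvd h j"
    if a: "a \<in> box p k" and b: "b \<in> box p k" and "a \<noteq> b"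
      and h: "\<forall>i<k. int p dvd (\<Sum>j<k. (M a i j - M b i j) * h j)" for a b h
  proof -
    \<comment> \<open>\<open>H\<close> is the field element with coordinates \<open>h\<close>, and
      \<open>D\<close> the difference of the elements given by \<open>a\<close> and
      \<open>b\<close>. Row \<open>i\<close> of the hypothesis says that the functional vanishes
      modulo \<open>p\<close> at \<open>D * H * X ^ i\<close>; hence \<open>D * H\<close> is zero in
      the field, while \<open>D\<close> is not.\<close>
    define H where "H = box_poly k h"
    define D where "D = box_poly k a - box_poly k b"
    have "int p dvd coord0 (D * H * ?X ^ i)" if "i < k" for i
    proof -
      have H: "H = (\<Sum>j<k. [:h j:] * ?X ^ j)" by (simp add: H_def box_poly_def monom_altdef)
      let ?A = "\<lambda>c. \<Sum>j<k. [:h j:] * (box_poly k c * ?X ^ (i + j))"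
      have A: "?A c = box_poly k c * H * ?X ^ i" for c
        by (simp add: H sum_distrib_left sum_distrib_right power_add algebra_simps)
      have 1: "int p dvd coord0 (?A c) - (\<Sum>j<k. h j * M c i j)" for c
        unfolding M_def by (rule coord0_sum) simp
      have eq: "D * H * ?X ^ i = ?A a + [:-1:] * ?A b"
        unfolding A by (simp add: D_def algebra_simps)
      have 2: "int p dvd coord0 (D * H * ?X ^ i) - (coord0 (?A a) + (-1) * coord0 (?A b))"
        unfolding eq by (rule coord0_lincomb)
      have "(\<Sum>j<k. h j * M a i j) - (\<Sum>j<k. h j * M b i j) = (\<Sum>j<k. (M a i j - M b i j) * h j)"
        by (simp add: sum_subtractf[symmetric] algebra_simps)
      then have 3: "int p dvd (\<Sum>j<k. h j * M a i j) - (\<Sum>j<k. h j * M b i j)"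
        using h \<open>i < k\<close> by simp
      have "int p dvd (coord0 (D * H * ?X ^ i) - (coord0 (?A a) + (-1) * coord0 (?A b)))
          + ((coord0 (?A a) - (\<Sum>j<k. h j * M a i j)) - (coord0 (?A b) - (\<Sum>j<k. h j * M b i j)))
          + ((\<Sum>j<k. h j * M a i j) - (\<Sum>j<k. h j * M b i j))"
        by (intro dvd_add dvd_diff 1 2 3)
      then show ?thesis by (simp add: algebra_simps)
    qed
    then have "D * H \<in> I" by (rule coord0_nondegenerate)
    moreover have "D \<notin> I"
    proof
      assume "D \<in> I"
      then have "box_poly k a = box_poly k b"
        using a b ex_basis by (intro reduced_eqI[of k]) (auto simp: reduced_eq_image D_def)
      then have "a i = b i" if "i < k" for i
        using that coeff_box_poly[of k _ i] by metis
      then show False using a b \<open>a \<noteq> b\<close> by (metis PiE_ext lessThan_iff)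
    qed
    ultimately have "H \<in> I" using max_ideal_prime[OF max] by blast
    then have "int p dvd coeff H j" for j using ex_basis lowdeg_box_poly by (metis H_def)
    then show ?thesis by (metis H_def coeff_box_poly)
  qed
  moreover have "M a i j = M a j i" for a i j by (simp add: M_def add.commute)
  ultimately show ?thesis by blast
qed

section \<open>Characters and Gauss sums\<close>

definition root_char :: "nat \<Rightarrow> int \<Rightarrow> complex" where
  "root_char p n = cis (2 * pi * of_int n / of_nat p)"

lemma root_char_0 [simp]: "root_char p 0 = 1"
  by (simp add: root_char_def)

lemma root_char_add: "root_char p (a + b) = root_char p a * root_char p b"
  by (simp add: root_char_def cis_mult add_divide_distrib algebra_simps)

lemma norm_root_char [simp]: "norm (root_char p a) = 1"
  by (simp add: root_char_def)

lemma cnj_root_char: "cnj (root_char p a) = root_char p (- a)"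
  by (simp add: root_char_def cis_cnj)

lemma root_char_sum: "root_char p (sum f A) = (\<Prod>i\<in>A. root_char p (f i))"
  by (induction A rule: infinite_finite_induct) (simp_all add: root_char_add)

lemma root_char_eq_1_iff:
  assumes "p > 0"
  shows "root_char p a = 1 \<longleftrightarrow> int p dvd a"
proof
  assume "root_char p a = 1"
  then have "cos (2 * pi * of_int a / of_nat p) = 1"
    by (simp add: root_char_def complex_eq_iff)
  then obtain k :: int where "2 * pi * of_int a / of_nat p = of_int k * 2 * pi"
    by (auto simp: cos_one_2pi_int)
  then have "(2 * pi) * of_int a = (2 * pi) * (of_int k * of_nat p)"
    using assms by (simp add: field_simps)
  then have "real_of_int a = of_int k * of_nat p" by (simp only: mult_cancel_left) simp
  then have "real_of_int a = of_int (k * int p)" by simp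
  then have "a = k * int p" by (simp only: of_int_eq_iff)
  then show "int p dvd a" by simp
next
  assume "int p dvd a"
  then obtain k where "a = int p * k" by auto
  then have eq: "2 * pi * of_int a / of_nat p = 2 * pi * of_int k" using assms by simp
  show "root_char p a = 1" unfolding root_char_def eq by (simp only: cis_multiple_2pi Ints_of_int)
qed

lemma root_char_mult_nat: "root_char p (a * int u) = root_char p a ^ u"
  by (induction u) (simp_all add: root_char_add algebra_simps)

lemma sum_root_char:
  assumes p: "p > 0"
  shows "(\<Sum>u\<in>{0..<int p}. root_char p (h * u)) = (if int p dvd h then of_nat p else 0)"
proof -
  have "{0..<int p} = int ` {..<p}"
    by (simp add: image_int_atLeastLessThan lessThan_atLeast0)
  then have *: "(\<Sum>u\<in>{0..<int p}. root_char p (h * u)) = (\<Sum>u<p. root_char p h ^ u)"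
    by (simp add: sum.reindex root_char_mult_nat)
  show ?thesis
  proof (cases "int p dvd h")
    case True
    then have "root_char p h = 1" using root_char_eq_1_iff[OF p] by simp
    then show ?thesis using True by (simp add: *)
  next
    case False
    then have "root_char p h \<noteq> 1" using root_char_eq_1_iff[OF p] by simp
    moreover have "root_char p h ^ p = 1"
      using root_char_eq_1_iff[OF p, of "h * int p"] by (simp add: root_char_mult_nat)
    ultimately show ?thesis using False by (simp add: * geometric_sum)
  qed
qed

section \<open>Character sums over vectors modulo \<open>p\<close>\<close>

definition dotp :: "nat \<Rightarrow> (nat \<Rightarrow> int) \<Rightarrow> (nat \<Rightarrow> int) \<Rightarrow> int" where
  "dotp k h x = (\<Sum>i<k. h i * x i)"

lemma finite_box: "finite (box p k)"
  by (simp add: finite_PiE)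

lemma card_box: "card (box p k) = p ^ k"
  by (simp add: card_PiE)

text \<open>The sum splits into a product of one geometric sum per coordinate; a single coefficient
  that is nonzero modulo \<open>p\<close> makes it vanish.\<close>

lemma sum_root_char_dotp:
  assumes p: "p > 0"
  shows "(\<Sum>x\<in>box p k. root_char p (dotp k h x)) =
    (if \<forall>i<k. int p dvd h i then of_nat (p ^ k) else 0)"
proof -
  have "(\<Sum>x\<in>box p k. root_char p (dotp k h x)) = (\<Sum>x\<in>box p k. \<Prod>i<k. root_char p (h i * x i))"
    by (simp add: dotp_def root_char_sum)
  also have "\<dots> = (\<Prod>i<k. \<Sum>u\<in>{0..<int p}. root_char p (h i * u))"
    by (rule prod_sum_PiE[symmetric]) auto
  also have "\<dots> = (\<Prod>i<k. if int p dvd h i then of_nat p else 0)"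
    by (simp add: sum_root_char[OF p])
  also have "\<dots> = (if \<forall>i<k. int p dvd h i then of_nat (p ^ k) else 0)"
    by auto
  finally show ?thesis .
qed

lemma box_eqI:
  assumes "x \<in> box p k" "y \<in> box p k" "\<And>i. i < k \<Longrightarrow> int p dvd x i - y i"
  shows "x = y"
proof (rule PiE_ext[OF assms(1,2)])
  fix i assume i: "i \<in> {..<k}"
  then have "x i mod int p = y i mod int p" using assms(3) by (simp add: mod_eq_dvd_iff)
  moreover have "x i \<in> {0..<int p}" "y i \<in> {0..<int p}"
    using PiE_mem[OF assms(1) i] PiE_mem[OF assms(2) i] by simp_all
  ultimately show "x i = y i" by simp
qed

text \<open>A square root of the additive character. Its values at integral quadratic forms are
  periodic modulo \<open>p\<close> in each variable also for \<open>p = 2\<close>.\<close>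

definition half_char :: "nat \<Rightarrow> int \<Rightarrow> complex" where
  "half_char p n = cis (pi * of_int (if even p then n else (int p + 1) * n) / of_nat p)"

lemma half_char_0 [simp]: "half_char p 0 = 1"
  by (simp add: half_char_def)

lemma half_char_add: "half_char p (a + b) = half_char p a * half_char p b"
  by (simp add: half_char_def cis_mult add_divide_distrib[symmetric] algebra_simps)

lemma norm_half_char [simp]: "norm (half_char p a) = 1"
  by (simp add: half_char_def)

lemma cnj_half_char: "cnj (half_char p a) = half_char p (- a)"
  by (simp add: half_char_def cis_cnj)

lemma half_char_double:
  assumes "p > 0"
  shows "half_char p (2 * a) = root_char p a"
proof (cases "even p")
  case False
  have "half_char p (2 * a) = root_char p ((int p + 1) * a)"
    using False by (simp add: half_char_def root_char_def algebra_simps)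
  also have "(int p + 1) * a = int p * a + a" by (simp add: algebra_simps)
  also have "root_char p \<dots> = root_char p a"
    using root_char_eq_1_iff[OF assms, of "int p * a"] by (simp add: root_char_add)
  finally show ?thesis .
qed (simp add: half_char_def root_char_def algebra_simps)

text \<open>The exponent becomes an even multiple of \<open>p\<close>: for even \<open>p\<close> one
  of the two factors \<open>p\<close> supplies the 2, for odd \<open>p\<close> the factor
  \<open>p + 1\<close> does. With a single factor \<open>p\<close> the value could be -1 at
  \<open>p = 2\<close>.\<close>

lemma half_char_square:
  assumes "p > 0"
  shows "half_char p ((int p)\<^sup>2 * a) = 1"
proof -
  obtain c where c: "(if even p then (int p)\<^sup>2 * a else (int p + 1) * ((int p)\<^sup>2 * a)) = int p * (2 * c)"
  proof (cases "even p")
    case True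
    then obtain b where "int p = 2 * b" by (metis dvd_def even_of_nat)
    then have "(int p)\<^sup>2 * a = int p * (2 * (b * a))" by (simp add: power2_eq_square)
    then show ?thesis using that True by metis
  next
    case False
    then obtain b where "int p + 1 = 2 * b" by (metis dvd_def even_of_nat odd_even_add odd_one)
    then have "(int p + 1) * ((int p)\<^sup>2 * a) = int p * (2 * (b * int p * a))"
      by (simp add: power2_eq_square)
    then show ?thesis using that False by metis
  qed
  have eq: "pi * of_int (int p * (2 * c)) / of_nat p = 2 * pi * of_int c" using assms by simp
  show ?thesis unfolding half_char_def c eq by (simp only: cis_multiple_2pi Ints_of_int)
qed

section \<open>Quadratic forms and chirps\<close>

definition quad :: "nat \<Rightarrow> (nat \<Rightarrow> nat \<Rightarrow> int) \<Rightarrow> (nat \<Rightarrow> int) \<Rightarrow> int" where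
  "quad k D x = (\<Sum>i<k. \<Sum>j<k. D i j * x i * x j)"

definition mat_act :: "nat \<Rightarrow> (nat \<Rightarrow> nat \<Rightarrow> int) \<Rightarrow> (nat \<Rightarrow> int) \<Rightarrow> nat \<Rightarrow> int" where
  "mat_act k D y i = (\<Sum>j<k. D i j * y j)"

text \<open>The two mixed sums agree by symmetry. The resulting factor 2 is what
  \<open>half_char_double\<close> turns into a linear character in \<open>chirp_add\<close>.\<close>

lemma quad_add:
  assumes "\<And>i j. D i j = D j i"
  shows "quad k D (\<lambda>i. x i + y i) = quad k D x + quad k D y + 2 * dotp k (mat_act k D y) x"
proof -
  have "(\<Sum>i<k. \<Sum>j<k. D i j * y i * x j) = (\<Sum>j<k. \<Sum>i<k. D i j * y i * x j)" by (rule sum.swap)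
  also have "\<dots> = (\<Sum>i<k. \<Sum>j<k. D i j * x i * y j)"
    using assms by (intro sum.cong refl) (simp add: mult.commute mult.left_commute)
  finally have *: "(\<Sum>i<k. \<Sum>j<k. D i j * y i * x j) = (\<Sum>i<k. \<Sum>j<k. D i j * x i * y j)" .
  have "dotp k (mat_act k D y) x = (\<Sum>i<k. \<Sum>j<k. D i j * x i * y j)"
    by (simp add: dotp_def mat_act_def sum_distrib_right sum_distrib_left mult_ac)
  moreover have "quad k D (\<lambda>i. x i + y i) =
      (\<Sum>i<k. \<Sum>j<k. D i j * x i * x j + D i j * y i * y j + (D i j * x i * y j + D i j * y i * x j))"
    unfolding quad_def by (intro sum.cong refl) (simp add: algebra_simps)
  then have "quad k D (\<lambda>i. x i + y i) = quad k D x + quad k D y +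
      ((\<Sum>i<k. \<Sum>j<k. D i j * x i * y j) + (\<Sum>i<k. \<Sum>j<k. D i j * y i * x j))"
    by (simp only: quad_def sum.distrib)
  ultimately show ?thesis using * by simp
qed

definition chirp :: "nat \<Rightarrow> nat \<Rightarrow> (nat \<Rightarrow> nat \<Rightarrow> int) \<Rightarrow> (nat \<Rightarrow> int) \<Rightarrow> (nat \<Rightarrow> int) \<Rightarrow> complex" where
  "chirp p k D d x = half_char p (quad k D x) * root_char p (dotp k d x)"

lemma norm_chirp [simp]: "norm (chirp p k D d x) = 1"
  by (simp add: chirp_def norm_mult)

lemma chirp_add:
  assumes "p > 0" "\<And>i j. D i j = D j i"
  shows "chirp p k D d (\<lambda>i. x i + y i) =
    chirp p k D d x * chirp p k D d y * root_char p (dotp k (mat_act k D y) x)"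
proof -
  have "dotp k d (\<lambda>i. x i + y i) = dotp k d x + dotp k d y"
    by (simp add: dotp_def algebra_simps sum.distrib)
  then show ?thesis
    by (simp add: chirp_def quad_add[OF assms(2)] half_char_add root_char_add half_char_double[OF assms(1)])
qed

text \<open>Write \<open>x\<close> as \<open>y\<close> plus \<open>p\<close> times an integral
  vector. The pure quadratic term of the increment carries the square of \<open>p\<close>, which
  \<open>half_char_square\<close> removes; the mixed and linear terms are multiples of
  \<open>p\<close> inside \<open>root_char\<close>.\<close>

lemma chirp_cong:
  assumes p: "p > 0" and D: "\<And>i j. D i j = D j i" and xy: "\<And>i. i < k \<Longrightarrow> int p dvd x i - y i"
  shows "chirp p k D d x = chirp p k D d y"
proof -
  define w where "w = (\<lambda>i. int p * ((x i - y i) div int p))"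
  have x: "x i = y i + w i" if "i < k" for i using xy[OF that] by (simp add: w_def)
  have "chirp p k D d x = chirp p k D d (\<lambda>i. y i + w i)"
    unfolding chirp_def quad_def dotp_def using x by simp
  also have "\<dots> = chirp p k D d y * chirp p k D d w * root_char p (dotp k (mat_act k D w) y)"
    by (rule chirp_add[OF p D])
  also have "chirp p k D d w = 1"
  proof -
    have "quad k D w = (int p)\<^sup>2 * quad k D (\<lambda>i. (x i - y i) div int p)"
      by (simp add: quad_def w_def sum_distrib_left power2_eq_square mult_ac)
    moreover have "int p dvd dotp k d w" unfolding dotp_def w_def by (intro dvd_sum) auto
    ultimately show ?thesis
      using half_char_square[OF p] root_char_eq_1_iff[OF p] by (simp add: chirp_def)
  qed
  also have "root_char p (dotp k (mat_act k D w) y) = 1"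
    unfolding root_char_eq_1_iff[OF p] dotp_def mat_act_def w_def
    by (auto intro!: dvd_sum simp: sum_distrib_right)
  finally show ?thesis by simp
qed

text \<open>Translation by \<open>y\<close> permutes the vectors modulo \<open>p\<close>. Returning
  to the box requires reducing each coordinate, to which \<open>f\<close> is insensitive by
  assumption.\<close>

lemma sum_box_shift:
  assumes p: "p > 0" and y: "y \<in> box p k"
    and f: "\<And>x x'. (\<And>i. i < k \<Longrightarrow> int p dvd x i - x' i) \<Longrightarrow> f x = f x'"
  shows "(\<Sum>x\<in>box p k. f x) = (\<Sum>h\<in>box p k. f (\<lambda>i. y i + h i))"
proof -
  define s where "s = (\<lambda>h. restrict (\<lambda>i. (y i + h i) mod int p) {..<k})"
  define t where "t = (\<lambda>x. restrict (\<lambda>i. (x i - y i) mod int p) {..<k})"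
  have m: "int p dvd a mod int p - a" for a by (metis mod_eq_dvd_iff mod_mod_trivial)
  have mem: "s h \<in> box p k" "t h \<in> box p k" for h
    using p by (auto simp: s_def t_def intro!: PiE_I)
  have st: "int p dvd s (t x) i - x i" and ts: "int p dvd t (s x) i - x i"
    and yt: "int p dvd (y i + t x i) - x i" if "i < k" for x i
  proof -
    let ?a = "x i - y i" and ?b = "y i + x i"
    have 1: "int p dvd ((y i + ?a mod int p) mod int p - (y i + ?a mod int p)) + (?a mod int p - ?a)"
      by (rule dvd_add[OF m m])
    have 2: "int p dvd ((?b mod int p - y i) mod int p - (?b mod int p - y i)) + (?b mod int p - ?b)"
      by (rule dvd_add[OF m m])
    show "int p dvd s (t x) i - x i" using 1 that by (simp add: s_def t_def)
    show "int p dvd t (s x) i - x i" using 2 that by (simp add: s_def t_def)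
    show "int p dvd (y i + t x i) - x i" using m[of ?a] that by (simp add: t_def algebra_simps)
  qed
  show ?thesis
  proof (rule sum.reindex_bij_witness[where i = s and j = t])
    show "s (t x) = x" if "x \<in> box p k" for x
      by (rule box_eqI[OF mem(1) that st])
    show "t (s h) = h" if "h \<in> box p k" for h
      by (rule box_eqI[OF mem(2) that ts])
    show "f (\<lambda>i. y i + t x i) = f x" for x
      by (rule f[OF yt])
  qed (rule mem)+
qed

text \<open>In the sum times its conjugate, the substitution \<open>x = y + h\<close> makes the sum over \<open>y\<close> a character
  sum, which vanishes unless \<open>h = 0\<close>.\<close>

lemma gauss_sum_norm:
  assumes p: "p > 0" and D: "\<And>i j. D i j = D j i"
    and nondeg: "\<And>h. (\<forall>i<k. int p dvd mat_act k D h i) \<Longrightarrow> (\<forall>j<k. int p dvd h j)"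
  shows "(cmod (\<Sum>x\<in>box p k. chirp p k D d x))\<^sup>2 = of_nat (p ^ k)"
proof -
  let ?F = "chirp p k D d"
  define S where "S = (\<Sum>x\<in>box p k. ?F x)"
  \<comment> \<open>The zero vector, restricted to an extensional function so that it lies in the
    box.\<close>
  define z where "z = restrict (\<lambda>_. 0 :: int) {..<k}"
  have FF: "?F x * cnj (?F x) = 1" for x
    by (simp add: complex_norm_square[symmetric])
  have "S * cnj S = (\<Sum>y\<in>box p k. \<Sum>x\<in>box p k. ?F x * cnj (?F y))"
    unfolding S_def cnj_sum sum_product by (rule sum.swap)
  also have "\<dots> = (\<Sum>y\<in>box p k. \<Sum>h\<in>box p k. ?F h * root_char p (dotp k (mat_act k D h) y))"
  proof (rule sum.cong[OF refl])
    fix y assume y: "y \<in> box p k"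
    have "(\<Sum>x\<in>box p k. ?F x * cnj (?F y)) = (\<Sum>h\<in>box p k. ?F (\<lambda>i. y i + h i) * cnj (?F y))"
    proof (rule sum_box_shift[OF p y, where f = "\<lambda>x. ?F x * cnj (?F y)"])
      fix x x' :: "nat \<Rightarrow> int" assume "\<And>i. i < k \<Longrightarrow> int p dvd x i - x' i"
      then have "?F x = ?F x'" by (rule chirp_cong[OF p D])
      then show "?F x * cnj (?F y) = ?F x' * cnj (?F y)" by simp
    qed
    also have "\<dots> = (\<Sum>h\<in>box p k. (?F y * cnj (?F y)) * (?F h * root_char p (dotp k (mat_act k D h) y)))"
      by (simp add: chirp_add[OF p D] mult_ac)
    finally show "(\<Sum>x\<in>box p k. ?F x * cnj (?F y)) =
        (\<Sum>h\<in>box p k. ?F h * root_char p (dotp k (mat_act k D h) y))" by (simp add: FF)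
  qed
  also have "\<dots> = (\<Sum>h\<in>box p k. ?F h * (\<Sum>y\<in>box p k. root_char p (dotp k (mat_act k D h) y)))"
    by (subst sum.swap) (simp only: sum_distrib_left)
  also have "\<dots> = (\<Sum>h\<in>box p k. if h = z then of_nat (p ^ k) else 0)"
  proof (intro sum.cong refl)
    fix h assume h: "h \<in> box p k"
    have zb: "z \<in> box p k" using p by (auto simp: z_def)
    have "(\<forall>i<k. int p dvd mat_act k D h i) \<longleftrightarrow> h = z"
    proof
      assume "\<forall>i<k. int p dvd mat_act k D h i"
      then have "\<forall>j<k. int p dvd h j" by (rule nondeg)
      then show "h = z" by (intro box_eqI[OF h zb]) (auto simp: z_def)
    qed (auto simp: z_def mat_act_def)
    moreover have "?F z = 1" by (simp add: chirp_def quad_def dotp_def z_def)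
    ultimately show "?F h * (\<Sum>y\<in>box p k. root_char p (dotp k (mat_act k D h) y)) =
        (if h = z then of_nat (p ^ k) else 0)"
      unfolding sum_root_char_dotp[OF p] by simp
  qed
  also have "\<dots> = of_nat (p ^ k)" using p finite_box[of k p] by (auto simp: z_def)
  finally have "complex_of_real ((cmod S)\<^sup>2) = of_real (of_nat (p ^ k))"
    by (simp only: complex_norm_square of_real_of_nat_eq)
  then show ?thesis unfolding S_def of_real_eq_iff .
qed

section \<open>Mutually unbiased bases\<close>

text \<open>Inner products of two chirps thereby become single Gauss sums for the difference of the
  matrices; equal matrices leave a plain character sum.\<close>

lemma chirp_mult_cnj:
  "chirp p k D b x * cnj (chirp p k D' c x) = chirp p k (\<lambda>i j. D i j - D' i j) (\<lambda>i. b i - c i) x"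
proof -
  have "quad k (\<lambda>i j. D i j - D' i j) x = quad k D x + - quad k D' x"
    by (simp add: quad_def left_diff_distrib sum_subtractf)
  moreover have "dotp k (\<lambda>i. b i - c i) x = dotp k b x + - dotp k c x"
    by (simp add: dotp_def left_diff_distrib sum_subtractf)
  ultimately show ?thesis
    by (simp only: chirp_def half_char_add root_char_add complex_cnj_mult cnj_half_char cnj_root_char mult_ac)
qed

text \<open>The label \<open>None\<close> stands for the standard basis and \<open>Some a\<close>
  for the chirps with matrix \<open>M a\<close>, divided by the square root of \<open>p ^ k\<close>.
  Two chirp bases are unbiased by \<open>gauss_sum_norm\<close>, since the difference of their
  matrices is nonsingular modulo \<open>p\<close>; against the standard basis it suffices that
  chirps have constant modulus.\<close>

lemma ex_mutually_unbiased_bases: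
  fixes p k :: nat
  assumes prime: "prime p" and k: "k > 0"
  defines "bases \<equiv> insert None (Some ` box p k)"
  shows "\<exists>v :: (nat \<Rightarrow> int) option \<Rightarrow> (nat \<Rightarrow> int) \<Rightarrow> (nat \<Rightarrow> int) \<Rightarrow> complex.
    (\<forall>\<beta>\<in>bases. \<forall>b\<in>box p k. \<forall>c\<in>box p k.
      (\<Sum>x\<in>box p k. v \<beta> b x * cnj (v \<beta> c x)) = of_bool (b = c)) \<and>
    (\<forall>\<beta>\<in>bases. \<forall>x\<in>box p k. \<forall>y\<in>box p k.
      (\<Sum>b\<in>box p k. v \<beta> b x * cnj (v \<beta> b y)) = of_bool (x = y)) \<and>
    (\<forall>\<beta>\<in>bases. \<forall>\<gamma>\<in>bases. \<beta> \<noteq> \<gamma> \<longrightarrow> (\<forall>b\<in>box p k. \<forall>c\<in>box p k.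
      (cmod (\<Sum>x\<in>box p k. v \<beta> b x * cnj (v \<gamma> c x)))\<^sup>2 = 1 / real (p ^ k)))"
proof -
  have p: "p > 0" using prime prime_gt_0_nat by blast
  from ex_symmetric_matrix_family[OF prime k]
  obtain M :: "(nat \<Rightarrow> int) \<Rightarrow> nat \<Rightarrow> nat \<Rightarrow> int" where sym': "\<forall>a i j. M a i j = M a j i"
    and M': "\<forall>a\<in>box p k. \<forall>b\<in>box p k. a \<noteq> b \<longrightarrow>
      (\<forall>h. (\<forall>i<k. int p dvd (\<Sum>j<k. (M a i j - M b i j) * h j)) \<longrightarrow> (\<forall>j<k. int p dvd h j))"
    by (elim exE conjE) (rule that)
  have sym: "M a i j = M a j i" for a i j using sym' by (elim allE)
  have M: "\<forall>j<k. int p dvd h j" if "a \<in> box p k" "b \<in> box p k" "a \<noteq> b"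
      "\<forall>i<k. int p dvd (\<Sum>j<k. (M a i j - M b i j) * h j)" for a b h
    using M'[rule_format, OF that(1-3)] that(4) by blast
  define r where "r = complex_of_real (1 / sqrt (p ^ k))"
  define v where "v = (\<lambda>\<beta> b x. case \<beta> of None \<Rightarrow> of_bool (b = x) | Some a \<Rightarrow> r * chirp p k (M a) b x)"
  have v_None: "v None b x = of_bool (b = x)" and v_Some: "v (Some a) b x = r * chirp p k (M a) b x"
    for a b x by (simp_all add: v_def)
  have r: "r * cnj r = 1 / of_nat (p ^ k)"
  proof -
    have "r * cnj r = of_real (1 / sqrt (p ^ k) * (1 / sqrt (p ^ k)))"
      by (simp only: r_def complex_cnj_complex_of_real of_real_mult)
    also have "1 / sqrt (p ^ k) * (1 / sqrt (p ^ k)) = 1 / real (p ^ k)" by simp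
    finally show ?thesis by simp
  qed
  have nr: "(cmod r)\<^sup>2 = 1 / real (p ^ k)"
    by (simp add: r_def norm_divide power_divide)
  have delta: "(\<Sum>x\<in>box p k. of_bool (b = x) * f x) = f b" if "b \<in> box p k" for b and f :: "_ \<Rightarrow> complex"
  proof -
    have "(\<Sum>x\<in>box p k. of_bool (b = x) * f x) = (\<Sum>x\<in>box p k. if b = x then f x else 0)"
      by (rule sum.cong) auto
    then show ?thesis using that by (simp only: sum.delta'[OF finite_box] if_True)
  qed
  have char: "(\<Sum>x\<in>box p k. root_char p (dotp k (\<lambda>i. b i - c i) x)) = of_bool (b = c) * of_nat (p ^ k)"
    if "b \<in> box p k" "c \<in> box p k" for b c
  proof -
    have "(\<forall>i<k. int p dvd b i - c i) \<longleftrightarrow> b = c"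
      using box_eqI[OF that] by auto
    then show ?thesis by (simp add: sum_root_char_dotp[OF p])
  qed
  have inner: "(\<Sum>x\<in>box p k. v (Some a) b x * cnj (v (Some a') c x)) =
      r * cnj r * (\<Sum>x\<in>box p k. chirp p k (\<lambda>i j. M a i j - M a' i j) (\<lambda>i. b i - c i) x)" for a a' b c
  proof -
    have "v (Some a) b x * cnj (v (Some a') c x) =
        r * cnj r * (chirp p k (M a) b x * cnj (chirp p k (M a') c x))" for x
      by (simp add: v_Some mult_ac)
    then show ?thesis by (simp only: chirp_mult_cnj sum_distrib_left)
  qed
  have "(\<Sum>x\<in>box p k. v \<beta> b x * cnj (v \<beta> c x)) = of_bool (b = c)"
    if "b \<in> box p k" "c \<in> box p k" for \<beta> b c
  proof (cases \<beta>)
    case None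
    have "(\<Sum>x\<in>box p k. v None b x * cnj (v None c x)) = cnj (v None c b)"
      unfolding v_None by (rule delta[OF that(1)])
    then show ?thesis by (auto simp: None v_None)
  next
    case (Some a)
    have "chirp p k (\<lambda>i j. M a i j - M a i j) d x = root_char p (dotp k d x)" for d x
      by (simp add: chirp_def quad_def)
    then show ?thesis using p by (simp add: Some inner char[OF that] r)
  qed
  moreover have "(\<Sum>b\<in>box p k. v \<beta> b x * cnj (v \<beta> b y)) = of_bool (x = y)"
    if "x \<in> box p k" "y \<in> box p k" for \<beta> x y
  proof (cases \<beta>)
    case None
    have "(\<Sum>b\<in>box p k. v None b x * cnj (v None b y)) = (\<Sum>b\<in>box p k. of_bool (x = b) * v None b y)"
      by (rule sum.cong) (auto simp: v_None)
    also have "\<dots> = v None x y" by (rule delta[OF that(1)])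
    finally show ?thesis by (simp add: None v_None)
  next
    case (Some a)
    \<comment> \<open>The quadratic phases at \<open>x\<close> and \<open>y\<close> do not depend on
      \<open>b\<close> and leave the sum; what remains is a character sum in
      \<open>b\<close>.\<close>
    let ?h = "half_char p (quad k (M a) x) * cnj (half_char p (quad k (M a) y))"
    have dot: "root_char p (dotp k b x) * cnj (root_char p (dotp k b y)) =
        root_char p (dotp k (\<lambda>i. x i - y i) b)" for b
      unfolding cnj_root_char root_char_add[symmetric]
      by (simp add: dotp_def algebra_simps sum_subtractf)
    have "v (Some a) b x * cnj (v (Some a) b y) =
        r * cnj r * ?h * (root_char p (dotp k b x) * cnj (root_char p (dotp k b y)))" for b
      by (simp add: v_Some chirp_def mult_ac)
    then have "(\<Sum>b\<in>box p k. v \<beta> b x * cnj (v \<beta> b y)) =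
        r * cnj r * ?h * (of_bool (x = y) * of_nat (p ^ k))"
      unfolding Some by (simp only: dot sum_distrib_left[symmetric] char[OF that])
    moreover have "?h = 1" if "x = y"
      using that by (simp add: complex_norm_square[symmetric])
    ultimately show ?thesis using p by (cases "x = y") (simp_all add: r)
  qed
  moreover have "(cmod (\<Sum>x\<in>box p k. v \<beta> b x * cnj (v \<gamma> c x)))\<^sup>2 = 1 / real (p ^ k)"
    if \<beta>: "\<beta> \<in> bases" and \<gamma>: "\<gamma> \<in> bases" and ne: "\<beta> \<noteq> \<gamma>" and b: "b \<in> box p k" and c: "c \<in> box p k" for \<beta> \<gamma> b c
  proof (cases \<beta>)
    case None
    then obtain a where a: "\<gamma> = Some a" using ne by (cases \<gamma>) auto
    have "(\<Sum>x\<in>box p k. v \<beta> b x * cnj (v \<gamma> c x)) = cnj (v \<gamma> c b)"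
      unfolding None v_None by (rule delta[OF b])
    then show ?thesis by (simp add: a v_Some norm_mult nr)
  next
    case (Some a)
    show ?thesis
    proof (cases \<gamma>)
      case None
      have "(\<Sum>x\<in>box p k. v \<beta> b x * cnj (v \<gamma> c x)) = (\<Sum>x\<in>box p k. of_bool (c = x) * v \<beta> b x)"
        by (rule sum.cong) (auto simp: None v_None)
      also have "\<dots> = v \<beta> b c" by (rule delta[OF c])
      finally show ?thesis by (simp add: Some v_Some norm_mult nr)
    next
      case (Some a')
      have a: "a \<in> box p k" "a' \<in> box p k" "a \<noteq> a'"
        using \<beta> \<gamma> ne Some \<open>\<beta> = Some a\<close> by (auto simp: bases_def)
      let ?D = "\<lambda>i j. M a i j - M a' i j"
      have "(cmod (\<Sum>x\<in>box p k. chirp p k ?D (\<lambda>i. b i - c i) x))\<^sup>2 = of_nat (p ^ k)"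
      proof (rule gauss_sum_norm[OF p])
        show "?D i j = ?D j i" for i j by (simp only: sym[of _ i j])
        show "\<forall>j<k. int p dvd h j" if "\<forall>i<k. int p dvd mat_act k ?D h i" for h
          using M[OF a] that by (simp add: mat_act_def)
      qed
      \<comment> \<open>The Gauss sum contributes \<open>p ^ k\<close> to the squared modulus and
        the normalisations contribute the inverse square of \<open>p ^ k\<close>.\<close>
      moreover have "(cmod (r * cnj r))\<^sup>2 = (1 / real (p ^ k))\<^sup>2"
        by (simp only: r) (simp add: norm_divide norm_power)
      ultimately show ?thesis
        using p unfolding Some \<open>\<beta> = Some a\<close> inner norm_mult power_mult_distrib
        by (simp add: power2_eq_square field_simps)
    qed
  qed
  ultimately show ?thesis by blast
qed

section \<open>Affine hyperplanes\<close>

text \<open>The first nonzero coordinate is normalised to 1, so that every parallel class of hyperplanes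
  has exactly one normal vector here.\<close>

definition normals :: "nat \<Rightarrow> nat \<Rightarrow> (nat \<Rightarrow> int) set" where
  "normals p k = (\<Union>j<k. \<Pi>\<^sub>E i\<in>{..<k}. if i < j then {0} else if i = j then {1} else {0..<int p})"

definition hyperplane :: "nat \<Rightarrow> nat \<Rightarrow> (nat \<Rightarrow> int) \<Rightarrow> int \<Rightarrow> (nat \<Rightarrow> int) set" where
  "hyperplane p k c s = {x \<in> box p k. int p dvd dotp k c x - s}"

lemma normals_subset: "p > 1 \<Longrightarrow> normals p k \<subseteq> box p k"
  unfolding normals_def by (intro UN_least PiE_mono) auto

lemma normalsE:
  assumes "c \<in> normals p k"
  obtains j where "j < k" "c j = 1" "\<And>i. i < j \<Longrightarrow> c i = 0"
proof -
  obtain j where j: "j < k"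
    and c: "c \<in> (\<Pi>\<^sub>E i\<in>{..<k}. if i < j then {0} else if i = j then {1} else {0..<int p})"
    using assms by (auto simp: normals_def)
  show thesis
  proof (rule that[OF j])
    show "c j = 1" using PiE_mem[OF c, of j] j by simp
    show "c i = 0" if "i < j" for i using PiE_mem[OF c, of i] j that by simp
  qed
qed

text \<open>With the leading 1 at position \<open>j\<close>, exactly the \<open>k - Suc j\<close>
  later coordinates are free; vectors with different leading positions differ.\<close>

lemma card_normals: "card (normals p k) = (\<Sum>i<k. p ^ i)"
proof -
  define A where "A = (\<lambda>j. \<Pi>\<^sub>E i\<in>{..<k}. if i < j then {0} else if i = j then {1} else {0..<int p})"
  have card: "card (A j) = p ^ (k - Suc j)" if "j < k" for j
  proof -
    have "card (A j) = (\<Prod>i<k. if j < i then p else 1)"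
      unfolding A_def by (subst card_PiE) (auto intro!: prod.cong)
    also have "\<dots> = p ^ card {i \<in> {..<k}. j < i}"
      by (simp add: prod.If_cases Int_def)
    also have "{i \<in> {..<k}. j < i} = {Suc j..<k}" by auto
    finally show ?thesis by simp
  qed
  have disj: "A j \<inter> A j' = {}" if "j < j'" "j' < k" for j j'
  proof -
    have "c j = 1" "c' j = 0" if "c \<in> A j" "c' \<in> A j'" for c c'
      using PiE_mem[OF that(1)[unfolded A_def], of j] PiE_mem[OF that(2)[unfolded A_def], of j]
        \<open>j < j'\<close> \<open>j' < k\<close> by simp_all
    then show ?thesis by fastforce
  qed
  have "card (normals p k) = (\<Sum>j<k. card (A j))"
    unfolding normals_def A_def[symmetric]
  proof (rule card_UN_disjoint)
    show "\<forall>i\<in>{..<k}. finite (A i)" unfolding A_def by (auto intro!: finite_PiE)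
    show "\<forall>i\<in>{..<k}. \<forall>j\<in>{..<k}. i \<noteq> j \<longrightarrow> A i \<inter> A j = {}"
      using disj by (metis Int_commute lessThan_iff linorder_neqE_nat)
  qed simp
  also have "\<dots> = (\<Sum>j<k. p ^ (k - Suc j))" using card by simp
  also have "\<dots> = (\<Sum>i<k. p ^ i)" by (rule sum.nat_diff_reindex)
  finally show ?thesis .
qed

text \<open>Compare the leading positions. If they differ, the earlier one sees only one of the
  vectors and the later one then settles the other coefficient. If they coincide,
  \<open>u + v\<close> vanishes there modulo \<open>p\<close>, and a coordinate in which
  \<open>c\<close> and \<open>c'\<close> differ forces \<open>u\<close> to vanish.\<close>

lemma normals_independent:
  assumes p: "prime p" and c: "c \<in> normals p k" "c' \<in> normals p k" "c \<noteq> c'"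
    and uv: "\<And>i. i < k \<Longrightarrow> int p dvd u * c i + v * c' i"
  shows "int p dvd u" "int p dvd v"
proof -
  have box: "c \<in> box p k" "c' \<in> box p k" using c normals_subset prime_gt_1_nat[OF p] by blast+
  obtain j where j: "j < k" "c j = 1" "\<And>i. i < j \<Longrightarrow> c i = 0" using normalsE[OF c(1)] by blast
  obtain j' where j': "j' < k" "c' j' = 1" "\<And>i. i < j' \<Longrightarrow> c' i = 0" using normalsE[OF c(2)] by blast
  consider "j < j'" | "j' < j" | "j = j'" by linarith
  then have "int p dvd u \<and> int p dvd v"
  proof cases
    case 1
    then have "int p dvd u" using uv[OF j(1)] j j' by simp
    moreover from this have "int p dvd v" using uv[OF j'(1)] j' by (simp add: dvd_add_right_iff)
    ultimately show ?thesis by simp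
  next
    case 2
    then have "int p dvd v" using uv[OF j'(1)] j j' by simp
    moreover from this have "int p dvd u" using uv[OF j(1)] j by (simp add: dvd_add_left_iff)
    ultimately show ?thesis by simp
  next
    case 3
    then have s: "int p dvd u + v" using uv[OF j(1)] j j' by simp
    obtain i where i: "i < k" "\<not> int p dvd c i - c' i" using box_eqI[OF box] c(3) by blast
    have "int p dvd (u * c i + v * c' i) - (u + v) * c' i"
      using uv[OF i(1)] s by (intro dvd_diff dvd_mult2)
    then have "int p dvd u * (c i - c' i)" by (simp add: algebra_simps)
    then have "int p dvd u" using i p by (simp add: prime_dvd_mult_iff)
    then show ?thesis using s by (simp add: dvd_add_right_iff)
  qed
  then show "int p dvd u" "int p dvd v" by simp_all
qed

text \<open>Expanding the indicator in characters turns the counting of points on hyperplanes into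
  character sums.\<close>

lemma of_bool_dvd_char:
  assumes "p > 0"
  shows "of_nat p * of_bool (int p dvd a) = (\<Sum>u\<in>{0..<int p}. root_char p (u * a))"
  using sum_root_char[OF assms, of a] by (simp add: mult.commute)

text \<open>In the character expansion only \<open>u = 0\<close> survives, because \<open>c\<close>
  has a coordinate equal to 1. The factor \<open>p\<close> on the left avoids a division.\<close>

lemma card_hyperplane:
  assumes p: "prime p" and c: "c \<in> normals p k"
  shows "p * card (hyperplane p k c s) = p ^ k"
proof -
  have p0: "p > 0" using p prime_gt_0_nat by blast
  obtain j where j: "j < k" "c j = 1" using normalsE[OF c] by blast
  have "complex_of_nat (p * card (hyperplane p k c s)) =
      (\<Sum>x\<in>box p k. of_nat p * of_bool (int p dvd dotp k c x - s))"
    using finite_box[of k p]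
    by (simp add: hyperplane_def sum_distrib_left[symmetric] of_bool_def sum.If_cases Int_def)
  also have "\<dots> = (\<Sum>x\<in>box p k. \<Sum>u\<in>{0..<int p}. root_char p (u * (dotp k c x - s)))"
    by (simp only: of_bool_dvd_char[OF p0])
  also have "\<dots> = (\<Sum>u\<in>{0..<int p}. \<Sum>x\<in>box p k. root_char p (u * (dotp k c x - s)))"
    by (rule sum.swap)
  also have "\<dots> = (\<Sum>u\<in>{0..<int p}. if u = 0 then of_nat (p ^ k) else 0)"
  proof (rule sum.cong[OF refl])
    fix u assume u: "u \<in> {0..<int p}"
    have "root_char p (u * (dotp k c x - s)) =
        root_char p (- (u * s)) * root_char p (dotp k (\<lambda>i. u * c i) x)" for x
      unfolding root_char_add[symmetric] by (simp add: dotp_def algebra_simps sum_distrib_left)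
    then have "(\<Sum>x\<in>box p k. root_char p (u * (dotp k c x - s))) =
        root_char p (- (u * s)) * (if \<forall>i<k. int p dvd u * c i then of_nat (p ^ k) else 0)"
      by (simp only: sum_distrib_left[symmetric] sum_root_char_dotp[OF p0])
    moreover have "(\<forall>i<k. int p dvd u * c i) \<longleftrightarrow> u = 0"
    proof
      assume "\<forall>i<k. int p dvd u * c i"
      then have "int p dvd u" using j by force
      then show "u = 0" using u by (auto dest: zdvd_imp_le)
    qed simp
    ultimately show "(\<Sum>x\<in>box p k. root_char p (u * (dotp k c x - s))) = (if u = 0 then of_nat (p ^ k) else 0)"
      by simp
  qed
  also have "\<dots> = of_nat (p ^ k)" using p0 by simp
  finally show ?thesis by (simp only: of_nat_eq_iff)
qed

text \<open>Two indicators give two frequencies \<open>u\<close> and \<open>v\<close>; by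
  \<open>normals_independent\<close> only the term with both equal to 0 survives.\<close>

lemma card_hyperplane_Int:
  assumes p: "prime p" and c: "c \<in> normals p k" "c' \<in> normals p k" "c \<noteq> c'"
  shows "p\<^sup>2 * card (hyperplane p k c s \<inter> hyperplane p k c' s') = p ^ k"
proof -
  have p0: "p > 0" using p prime_gt_0_nat by blast
  define g where "g = (\<lambda>x u v. root_char p (u * (dotp k c x - s)) * root_char p (v * (dotp k c' x - s')))"
  let ?Z = "{0..<int p}"
  have "complex_of_nat (p\<^sup>2 * card (hyperplane p k c s \<inter> hyperplane p k c' s')) =
      (\<Sum>x\<in>box p k. of_nat (p\<^sup>2) * of_bool (int p dvd dotp k c x - s \<and> int p dvd dotp k c' x - s'))"
    using finite_box[of k p]
    by (simp add: hyperplane_def sum_distrib_left[symmetric] of_bool_def sum.If_cases Int_def conj_ac)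
  also have "\<dots> = (\<Sum>x\<in>box p k. (of_nat p * of_bool (int p dvd dotp k c x - s)) *
      (of_nat p * of_bool (int p dvd dotp k c' x - s')))"
    by (rule sum.cong) (auto simp: power2_eq_square)
  also have "\<dots> = (\<Sum>x\<in>box p k. \<Sum>u\<in>?Z. \<Sum>v\<in>?Z. g x u v)"
    by (simp only: of_bool_dvd_char[OF p0] sum_product g_def)
  also have "\<dots> = (\<Sum>u\<in>?Z. \<Sum>x\<in>box p k. \<Sum>v\<in>?Z. g x u v)"
    by (rule sum.swap)
  also have "\<dots> = (\<Sum>u\<in>?Z. \<Sum>v\<in>?Z. \<Sum>x\<in>box p k. g x u v)"
    by (rule sum.cong[OF refl sum.swap])
  also have "\<dots> = (\<Sum>u\<in>?Z. \<Sum>v\<in>?Z. if u = 0 then if v = 0 then of_nat (p ^ k) else 0 else 0)"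
  proof (rule sum.cong[OF refl], rule sum.cong[OF refl])
    fix u v assume u: "u \<in> ?Z" and v: "v \<in> ?Z"
    let ?h = "\<lambda>i. u * c i + v * c' i"
    have "g x u v = root_char p (- (u * s + v * s')) * root_char p (dotp k ?h x)" for x
      unfolding g_def root_char_add[symmetric]
      by (simp add: dotp_def algebra_simps sum_distrib_left sum.distrib)
    then have "(\<Sum>x\<in>box p k. g x u v) =
        root_char p (- (u * s + v * s')) * (if \<forall>i<k. int p dvd ?h i then of_nat (p ^ k) else 0)"
      by (simp only: sum_distrib_left[symmetric] sum_root_char_dotp[OF p0])
    moreover have "(\<forall>i<k. int p dvd ?h i) \<longleftrightarrow> u = 0 \<and> v = 0"
    proof
      assume "\<forall>i<k. int p dvd ?h i"
      then have "int p dvd u" "int p dvd v" using normals_independent[OF p c] by blast+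
      then show "u = 0 \<and> v = 0" using u v by (auto dest: zdvd_imp_le)
    qed simp
    ultimately show "(\<Sum>x\<in>box p k. g x u v) = (if u = 0 then if v = 0 then of_nat (p ^ k) else 0 else 0)"
      by simp
  qed
  also have "\<dots> = (\<Sum>u\<in>?Z. if u = 0 then of_nat (p ^ k) else 0)"
    using p0 by (intro sum.cong refl) simp
  also have "\<dots> = of_nat (p ^ k)" using p0 by simp
  finally show ?thesis by (simp only: of_nat_eq_iff)
qed

lemma hyperplane_Int_parallel:
  assumes "s \<in> {0..<int p}" "s' \<in> {0..<int p}" "s \<noteq> s'"
  shows "hyperplane p k c s \<inter> hyperplane p k c s' = {}"
proof -
  have False if "int p dvd a - s" "int p dvd a - s'" for a
  proof -
    have "a mod int p = s mod int p" "a mod int p = s' mod int p" using that by (simp_all add: mod_eq_dvd_iff)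
    then show False using assms by simp
  qed
  then show ?thesis by (auto simp: hyperplane_def)
qed

text \<open>For each normal \<open>c\<close>, the only hyperplane through \<open>x\<close> is the
  one whose offset is the residue of \<open>dotp k c x\<close>.\<close>

lemma card_hyperplanes_through:
  assumes "p > 0" and x: "x \<in> box p k"
  shows "card {(c, s) \<in> normals p k \<times> {0..<int p}. x \<in> hyperplane p k c s} = card (normals p k)"
proof -
  have res: "s \<in> {0..<int p} \<and> int p dvd a - s \<longleftrightarrow> s = a mod int p" for a s
  proof
    assume "s \<in> {0..<int p} \<and> int p dvd a - s"
    then have s: "int p dvd a - s" and "s mod int p = s" by simp_all
    moreover from s have "a mod int p = s mod int p" by (simp only: mod_eq_dvd_iff)
    ultimately show "s = a mod int p" by simp
  next
    assume "s = a mod int p"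
    then show "s \<in> {0..<int p} \<and> int p dvd a - s" using assms(1) by simp
  qed
  have "{(c, s) \<in> normals p k \<times> {0..<int p}. x \<in> hyperplane p k c s} =
      (\<lambda>c. (c, dotp k c x mod int p)) ` normals p k"
  proof (rule Set.set_eqI)
    fix z :: "(nat \<Rightarrow> int) \<times> int"
    obtain c s where z: "z = (c, s)" by (cases z)
    show "z \<in> {(c, s) \<in> normals p k \<times> {0..<int p}. x \<in> hyperplane p k c s} \<longleftrightarrow>
        z \<in> (\<lambda>c. (c, dotp k c x mod int p)) ` normals p k"
      using res[of s "dotp k c x"] x by (auto simp: z hyperplane_def)
  qed
  then show ?thesis by (simp add: card_image inj_on_def)
qed

section \<open>Fusion frames from mutually unbiased bases\<close>

lemma mat_adjoint_index:
  fixes A :: "complex mat"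
  assumes "A \<in> carrier_mat m m" "i < m" "j < m"
  shows "mat_adjoint A $$ (i, j) = cnj (A $$ (j, i))"
  using assms by (simp add: mat_adjoint_def mat_of_rows_index)

lemma mat_adjoint_carrier:
  fixes A :: "complex mat"
  assumes "A \<in> carrier_mat m m"
  shows "mat_adjoint A \<in> carrier_mat m m"
  using assms by (auto simp: mat_adjoint_def)

lemma hermitian_matI:
  assumes A: "A \<in> carrier_mat m m" and "\<And>i j. i < m \<Longrightarrow> j < m \<Longrightarrow> cnj (A $$ (j, i)) = A $$ (i, j)"
  shows "hermitian_mat A"
  unfolding hermitian_mat_def using assms mat_adjoint_carrier[OF A]
  by (intro eq_matI) (auto simp: mat_adjoint_index[OF A])

text \<open>Each summand is an outer product, of rank at most 1, and rank is subadditive.\<close>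

lemma rank_sum_products_le:
  fixes f g :: "'c \<Rightarrow> nat \<Rightarrow> complex"
  assumes "finite H"
  shows "vec_space.rank m (mat m m (\<lambda>(a, b). \<Sum>c\<in>H. f c a * g c b)) \<le> card H"
  using assms
proof (induction H rule: finite_induct)
  case empty
  interpret vec_space "TYPE(complex)" m .
  have "mat m m (\<lambda>(a, b). \<Sum>c\<in>{}. f c a * g c b) = 0\<^sub>m m m"
    by (intro eq_matI) auto
  then show ?case by (simp only: rank_0I card.empty)
next
  case (insert c H)
  interpret vec_space "TYPE(complex)" m .
  let ?A = "mat m m (\<lambda>(a, b). f c a * g c b)"
  let ?B = "mat m m (\<lambda>(a, b). \<Sum>c\<in>H. f c a * g c b)"
  have "mat m m (\<lambda>(a, b). \<Sum>c\<in>insert c H. f c a * g c b) = ?A + ?B"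
    using insert by (intro eq_matI) auto
  moreover have "rank (?A + ?B) \<le> rank ?A + rank ?B"
    by (rule rank_subadditive[of _ m]) auto
  moreover have "rank ?A \<le> 1"
    by (rule rank_le_1_product_entries[of _ m "f c" "g c"]) auto
  ultimately show ?case using insert by simp
qed

text \<open>The geometry enters only through blocks \<open>H j\<close> of size \<open>l\<close>.
  Regularity (\<open>through\<close>) gives tightness, \<open>Int\<close> keeps pairs from one basis
  at or below \<open>l\<^sup>2 / m\<close>, and pairs from different bases attain this value by
  unbiasedness. The equation \<open>count\<close> is the double count of incidences between points
  and blocks.\<close>

lemma ogff_of_mutually_unbiased_bases:
  fixes v :: "'b \<Rightarrow> 'x \<Rightarrow> 'x \<Rightarrow> complex" and H :: "'j \<Rightarrow> 'x set"
  assumes X: "finite X" "card X = m" and bases: "finite bases" "card bases = m + 1"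
    and J: "finite J" and n: "n = (m + 1) * card J"
    and ortho: "\<And>\<beta> b c. \<beta> \<in> bases \<Longrightarrow> b \<in> X \<Longrightarrow> c \<in> X \<Longrightarrow>
      (\<Sum>x\<in>X. v \<beta> b x * cnj (v \<beta> c x)) = of_bool (b = c)"
    and complete: "\<And>\<beta> x y. \<beta> \<in> bases \<Longrightarrow> x \<in> X \<Longrightarrow> y \<in> X \<Longrightarrow>
      (\<Sum>b\<in>X. v \<beta> b x * cnj (v \<beta> b y)) = of_bool (x = y)"
    and unbiased: "\<And>\<beta> \<gamma> b c. \<beta> \<in> bases \<Longrightarrow> \<gamma> \<in> bases \<Longrightarrow> \<beta> \<noteq> \<gamma> \<Longrightarrow> b \<in> X \<Longrightarrow> c \<in> X \<Longrightarrow>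
      (cmod (\<Sum>x\<in>X. v \<beta> b x * cnj (v \<gamma> c x)))\<^sup>2 = 1 / real m"
    and H: "\<And>j. j \<in> J \<Longrightarrow> H j \<subseteq> X" "\<And>j. j \<in> J \<Longrightarrow> card (H j) = l"
    and Int: "\<And>i j. i \<in> J \<Longrightarrow> j \<in> J \<Longrightarrow> i \<noteq> j \<Longrightarrow> m * card (H i \<inter> H j) \<le> l\<^sup>2"
    and through: "\<And>x. x \<in> X \<Longrightarrow> card {j \<in> J. x \<in> H j} = r"
    and count: "m * r = card J * l" and l: "l > 0" and m: "m > 0" and large: "n > m\<^sup>2"
  shows "\<exists>P. ogff m n l P \<and> tight m n l P"
proof -
  have J0: "card J > 0" using large n by (cases "card J") auto
  have r0: "r > 0" using count J0 l by (metis mult_is_0 neq0_conv)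
  have fH: "finite (H j)" if "j \<in> J" for j using H(1)[OF that] X(1) finite_subset by blast
  obtain f where "bij_betw f {0..<m} X" using ex_bij_betw_nat_finite[OF X(1)] X(2) by auto
  then have f: "bij_betw f {..<m} X" by (simp add: lessThan_atLeast0)
  have fX: "f a \<in> X" if "a < m" for a using f that by (auto simp: bij_betw_def)
  have f_eq: "f a = f b \<longleftrightarrow> a = b" if "a < m" "b < m" for a b
    using f that by (auto simp: bij_betw_def inj_on_def)
  have sum_f: "(\<Sum>a<m. h (f a)) = (\<Sum>x\<in>X. h x)" for h :: "'x \<Rightarrow> complex"
    by (rule sum.reindex_bij_betw[OF f])
  have "card (bases \<times> J) = n" by (simp add: card_cartesian_product bases n)
  then obtain g where g: "bij_betw g {1..n} (bases \<times> J)"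
    using ex_bij_betw_nat_finite_1[of "bases \<times> J"] bases(1) J by auto
  \<comment> \<open>For a basis \<beta> and \<open>K \<subseteq> X\<close>, this is the projection
    onto the span of the vectors of \<beta> labelled by \<open>K\<close>. The bijection
    \<open>f\<close> translates matrix indices into points of \<open>X\<close>.\<close>
  define Q where "Q = (\<lambda>\<beta> K. mat m m (\<lambda>(a, b). \<Sum>c\<in>K. v \<beta> c (f a) * cnj (v \<beta> c (f b))))"
  define P where "P = (\<lambda>i. Q (fst (g i)) (H (snd (g i))))"
  have g_mem: "fst (g i) \<in> bases" "snd (g i) \<in> J" if "i \<in> {1..n}" for i
    using bij_betw_apply[OF g that] by (simp_all add: mem_Times_iff)
  have Q_carrier: "Q \<beta> K \<in> carrier_mat m m" for \<beta> K by (simp add: Q_def)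
  have Q_index: "Q \<beta> K $$ (a, b) = (\<Sum>c\<in>K. v \<beta> c (f a) * cnj (v \<beta> c (f b)))" if "a < m" "b < m" for \<beta> K a b
    using that by (simp add: Q_def)
  have Q_herm: "hermitian_mat (Q \<beta> K)" for \<beta> K
    by (rule hermitian_matI[OF Q_carrier]) (simp add: Q_index mult.commute)
  \<comment> \<open>The Gram matrix between two bases; traces of products of projections depend only
    on its squared moduli.\<close>
  define G where "G = (\<lambda>\<beta> b \<gamma> c. \<Sum>x\<in>X. v \<beta> b x * cnj (v \<gamma> c x))"
  have Q_mult: "(Q \<beta> K * Q \<gamma> L) $$ (a, b) =
      (\<Sum>c\<in>K. \<Sum>d\<in>L. v \<beta> c (f a) * cnj (v \<gamma> d (f b)) * G \<gamma> d \<beta> c)" if "a < m" "b < m" for \<beta> \<gamma> K L a b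
  proof -
    have "(Q \<beta> K * Q \<gamma> L) $$ (a, b) = (\<Sum>e<m. Q \<beta> K $$ (a, e) * Q \<gamma> L $$ (e, b))"
      using that Q_carrier[of \<beta> K] Q_carrier[of \<gamma> L]
      by (simp add: scalar_prod_def atLeast0LessThan)
    also have "\<dots> = (\<Sum>e<m. \<Sum>c\<in>K. \<Sum>d\<in>L. (v \<beta> c (f a) * cnj (v \<gamma> d (f b))) *
        (v \<gamma> d (f e) * cnj (v \<beta> c (f e))))"
      using that by (intro sum.cong refl) (simp add: Q_index sum_product mult_ac)
    also have "\<dots> = (\<Sum>c\<in>K. \<Sum>e<m. \<Sum>d\<in>L. (v \<beta> c (f a) * cnj (v \<gamma> d (f b))) *
        (v \<gamma> d (f e) * cnj (v \<beta> c (f e))))"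
      by (rule sum.swap)
    also have "\<dots> = (\<Sum>c\<in>K. \<Sum>d\<in>L. \<Sum>e<m. (v \<beta> c (f a) * cnj (v \<gamma> d (f b))) *
        (v \<gamma> d (f e) * cnj (v \<beta> c (f e))))"
      by (rule sum.cong[OF refl sum.swap])
    also have "\<dots> = (\<Sum>c\<in>K. \<Sum>d\<in>L. v \<beta> c (f a) * cnj (v \<gamma> d (f b)) * G \<gamma> d \<beta> c)"
      unfolding G_def sum_distrib_left[symmetric]
      by (simp only: sum_f[of "\<lambda>x. v _ _ x * cnj (v _ _ x)"])
    finally show ?thesis .
  qed
  have trace: "mat_trace (Q \<beta> K * Q \<gamma> L) = of_real (\<Sum>c\<in>K. \<Sum>d\<in>L. (cmod (G \<gamma> d \<beta> c))\<^sup>2)" for \<beta> \<gamma> K L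
  proof -
    have "mat_trace (Q \<beta> K * Q \<gamma> L) =
        (\<Sum>a<m. \<Sum>c\<in>K. \<Sum>d\<in>L. v \<beta> c (f a) * cnj (v \<gamma> d (f a)) * G \<gamma> d \<beta> c)"
      using Q_carrier[of \<beta> K] by (simp add: mat_trace_def Q_mult)
    also have "\<dots> = (\<Sum>c\<in>K. \<Sum>a<m. \<Sum>d\<in>L. v \<beta> c (f a) * cnj (v \<gamma> d (f a)) * G \<gamma> d \<beta> c)"
      by (rule sum.swap)
    also have "\<dots> = (\<Sum>c\<in>K. \<Sum>d\<in>L. \<Sum>a<m. v \<beta> c (f a) * cnj (v \<gamma> d (f a)) * G \<gamma> d \<beta> c)"
      by (rule sum.cong[OF refl sum.swap])
    also have "\<dots> = (\<Sum>c\<in>K. \<Sum>d\<in>L. G \<beta> c \<gamma> d * G \<gamma> d \<beta> c)"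
      unfolding G_def sum_distrib_right[symmetric]
      by (simp only: sum_f[of "\<lambda>x. v _ _ x * cnj (v _ _ x)"])
    also have "\<dots> = (\<Sum>c\<in>K. \<Sum>d\<in>L. of_real ((cmod (G \<gamma> d \<beta> c))\<^sup>2))"
    proof (intro sum.cong refl)
      fix c d
      have "G \<beta> c \<gamma> d = cnj (G \<gamma> d \<beta> c)" by (simp add: G_def mult.commute)
      then show "G \<beta> c \<gamma> d * G \<gamma> d \<beta> c = of_real ((cmod (G \<gamma> d \<beta> c))\<^sup>2)"
        unfolding complex_norm_square by (simp only: mult.commute)
    qed
    finally show ?thesis by simp
  qed
  have G_same: "G \<beta> b \<beta> c = of_bool (b = c)" if "\<beta> \<in> bases" "b \<in> X" "c \<in> X" for \<beta> b c
    unfolding G_def by (rule ortho[OF that])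
  have idem: "Q \<beta> K * Q \<beta> K = Q \<beta> K" if \<beta>: "\<beta> \<in> bases" and K: "K \<subseteq> X" for \<beta> K
  proof (rule eq_matI)
    have fK: "finite K" using K X(1) finite_subset by blast
    fix a b assume "a < dim_row (Q \<beta> K)" "b < dim_col (Q \<beta> K)"
    then have ab: "a < m" "b < m" using Q_carrier[of \<beta> K] by auto
    have "(\<Sum>d\<in>K. v \<beta> c (f a) * cnj (v \<beta> d (f b)) * G \<beta> d \<beta> c) = v \<beta> c (f a) * cnj (v \<beta> c (f b))"
      if "c \<in> K" for c
    proof -
      have "(\<Sum>d\<in>K. v \<beta> c (f a) * cnj (v \<beta> d (f b)) * G \<beta> d \<beta> c) =
          (\<Sum>d\<in>K. if d = c then v \<beta> c (f a) * cnj (v \<beta> c (f b)) else 0)"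
        using K that by (intro sum.cong refl) (auto simp: G_same[OF \<beta>] subset_eq)
      then show ?thesis using that fK by simp
    qed
    then show "(Q \<beta> K * Q \<beta> K) $$ (a, b) = Q \<beta> K $$ (a, b)"
      using ab by (simp add: Q_mult Q_index)
  qed (use Q_carrier[of \<beta> K] in auto)
  have rank: "vec_space.rank m (Q \<beta> K) = card K" if \<beta>: "\<beta> \<in> bases" and K: "K \<subseteq> X" for \<beta> K
  proof -
    interpret vec_space "TYPE(complex)" m .
    have fK: "finite K" using K X(1) finite_subset by blast
    have le: "rank (Q \<beta> L) \<le> card L" if "finite L" for L
      unfolding Q_def by (rule rank_sum_products_le[OF that])
    \<comment> \<open>The lower bound comes from subadditivity, as the complementary projection has rank at most
      \<open>m - card K\<close>.\<close>
    have "Q \<beta> K + Q \<beta> (X - K) = 1\<^sub>m m"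
    proof (rule eq_matI)
      fix a b assume "a < dim_row (1\<^sub>m m)" "b < dim_col (1\<^sub>m m)"
      then have ab: "a < m" "b < m" by auto
      have "(Q \<beta> K + Q \<beta> (X - K)) $$ (a, b) = (\<Sum>c\<in>X. v \<beta> c (f a) * cnj (v \<beta> c (f b)))"
        using ab Q_carrier[of \<beta> K] Q_carrier[of \<beta> "X - K"]
        by (simp add: Q_index sum.subset_diff[OF K X(1)] add.commute)
      then show "(Q \<beta> K + Q \<beta> (X - K)) $$ (a, b) = 1\<^sub>m m $$ (a, b)"
        using ab by (simp add: complete[OF \<beta> fX fX] f_eq)
    qed (use Q_carrier in auto)
    moreover have "rank (1\<^sub>m m) = m" using det_rank_iff[of "1\<^sub>m m"] by simp
    ultimately have "m \<le> rank (Q \<beta> K) + rank (Q \<beta> (X - K))"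
      using rank_subadditive[OF Q_carrier Q_carrier] by metis
    also have "rank (Q \<beta> (X - K)) \<le> m - card K"
      using le[of "X - K"] X fK K by (simp add: card_Diff_subset)
    finally have "m \<le> rank (Q \<beta> K) + (m - card K)" by simp
    moreover have "card K \<le> m" using card_mono[OF X(1) K] X(2) by simp
    ultimately show ?thesis using le[OF fK] by linarith
  qed
  have packing: "packing m n l P"
    unfolding packing_def orthogonal_projection_def
  proof (intro ballI conjI)
    fix i assume "i \<in> {1..n}"
    note gi = g_mem[OF this]
    show "P i \<in> carrier_mat m m" "hermitian_mat (P i)" unfolding P_def by (rule Q_carrier Q_herm)+
    show "P i * P i = P i" unfolding P_def by (rule idem[OF gi(1) H(1)[OF gi(2)]])
    show "vec_space.rank m (P i) = l"
      unfolding P_def rank[OF gi(1) H(1)[OF gi(2)]] by (rule H(2)[OF gi(2)])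
  qed
  \<comment> \<open>Interchanging the sums counts every point once for each of the \<open>r\<close>
    blocks through it.\<close>
  have count_blocks: "(\<Sum>j\<in>J. \<Sum>c\<in>H j. h c) = of_nat r * (\<Sum>c\<in>X. h c)" for h :: "'x \<Rightarrow> complex"
  proof -
    have "(\<Sum>j\<in>J. \<Sum>c\<in>H j. h c) = (\<Sum>j\<in>J. \<Sum>c\<in>X. of_bool (c \<in> H j) * h c)"
    proof (rule sum.cong[OF refl])
      fix j assume "j \<in> J"
      then have "X \<inter> H j = H j" using H(1) by blast
      moreover have "(\<Sum>c\<in>X. of_bool (c \<in> H j) * h c) = (\<Sum>c\<in>X. if c \<in> H j then h c else 0)"
        by (rule sum.cong) auto
      ultimately show "(\<Sum>c\<in>H j. h c) = (\<Sum>c\<in>X. of_bool (c \<in> H j) * h c)"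
        by (simp only: sum.inter_restrict[OF X(1), symmetric])
    qed
    also have "\<dots> = (\<Sum>c\<in>X. \<Sum>j\<in>J. of_bool (c \<in> H j) * h c)" by (rule sum.swap)
    also have "\<dots> = (\<Sum>c\<in>X. of_nat r * h c)"
    proof (rule sum.cong[OF refl])
      fix c assume "c \<in> X"
      have "(\<Sum>j\<in>J. of_bool (c \<in> H j)) = complex_of_nat (card {j \<in> J. c \<in> H j})"
        using J by (simp add: of_bool_def sum.If_cases Int_def)
      then show "(\<Sum>j\<in>J. of_bool (c \<in> H j) * h c) = of_nat r * h c"
        using through[OF \<open>c \<in> X\<close>] by (simp add: sum_distrib_right[symmetric])
    qed
    finally show ?thesis by (simp add: sum_distrib_left)
  qed
  \<comment> \<open>By completeness each of the \<open>m + 1\<close> bases contributes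
    \<open>r\<close> times the identity.\<close>
  define s where "s = real ((m + 1) * r)"
  have s0: "s > 0" unfolding s_def of_nat_0_less_iff using r0 by simp
  have seq: "mat_seq_sum m n P = of_real s \<cdot>\<^sub>m 1\<^sub>m m"
  proof (rule eq_matI)
    fix a b assume "a < dim_row (complex_of_real s \<cdot>\<^sub>m 1\<^sub>m m)" "b < dim_col (complex_of_real s \<cdot>\<^sub>m 1\<^sub>m m)"
    then have ab: "a < m" "b < m" by auto
    have "mat_seq_sum m n P $$ (a, b) = (\<Sum>i\<in>{1..n}. (\<lambda>(\<beta>, j). Q \<beta> (H j) $$ (a, b)) (g i))"
      using ab by (simp add: mat_seq_sum_def P_def case_prod_beta)
    also have "\<dots> = (\<Sum>(\<beta>, j)\<in>bases \<times> J. Q \<beta> (H j) $$ (a, b))"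
      by (rule sum.reindex_bij_betw[OF g])
    also have "\<dots> = (\<Sum>\<beta>\<in>bases. \<Sum>j\<in>J. \<Sum>c\<in>H j. v \<beta> c (f a) * cnj (v \<beta> c (f b)))"
      using ab by (simp add: sum.cartesian_product[symmetric] Q_index)
    also have "\<dots> = (\<Sum>\<beta>\<in>bases. of_nat r * of_bool (a = b))"
      using ab by (simp add: count_blocks complete[OF _ fX fX] f_eq)
    also have "\<dots> = of_nat ((m + 1) * r) * of_bool (a = b)"
      using bases by (simp add: algebra_simps)
    finally show "mat_seq_sum m n P $$ (a, b) = (complex_of_real s \<cdot>\<^sub>m 1\<^sub>m m) $$ (a, b)"
      using ab by (auto simp: s_def)
  qed (simp_all add: mat_seq_sum_def)
  have posdef: "positive_definite_mat m (mat_seq_sum m n P)"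
    unfolding positive_definite_mat_def seq
  proof (intro conjI ballI impI)
    show "hermitian_mat (of_real s \<cdot>\<^sub>m 1\<^sub>m m)"
      by (rule hermitian_matI[of _ m]) auto
    fix w :: "complex vec" assume w: "w \<in> carrier_vec m" "w \<noteq> 0\<^sub>v m"
    have "(of_real s \<cdot>\<^sub>m 1\<^sub>m m) *\<^sub>v w = of_real s \<cdot>\<^sub>v w"
      using w by (intro eq_vecI) (auto simp: scalar_prod_left_unit)
    then have "((of_real s \<cdot>\<^sub>m 1\<^sub>m m) *\<^sub>v w) \<bullet>c w = of_real s * (w \<bullet>c w)"
      using w by simp
    moreover have "w \<bullet>c w > 0" using w by (simp add: conjugate_square_greater_0_vec)
    then have "Re (w \<bullet>c w) > 0" by (simp add: less_complex_def)
    ultimately show "Re (((of_real s \<cdot>\<^sub>m 1\<^sub>m m) *\<^sub>v w) \<bullet>c w) > 0" using s0 by simp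
  qed auto
  have tight: "tight m n l P"
  proof -
    have "n * l = m * ((m + 1) * r)" using count n by (simp add: algebra_simps)
    then have "complex_of_nat (n * l) / of_nat m = of_real s" using m by (simp add: s_def)
    then show ?thesis by (simp only: tight_def seq)
  qed
  have Re_trace: "Re (mat_trace (P i * P i')) =
      (if fst (g i) = fst (g i') then real (card (H (snd (g i)) \<inter> H (snd (g i')))) else (real l)\<^sup>2 / real m)"
    if i: "i \<in> {1..n}" and i': "i' \<in> {1..n}" for i i'
  proof -
    let ?\<beta> = "fst (g i)" and ?\<gamma> = "fst (g i')" and ?K = "H (snd (g i))" and ?L = "H (snd (g i'))"
    have KL: "?K \<subseteq> X" "?L \<subseteq> X" "finite ?K" "finite ?L" "card ?K = l" "card ?L = l"
      using g_mem[OF i] g_mem[OF i'] H fH by auto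
    have Re: "Re (mat_trace (P i * P i')) = (\<Sum>c\<in>?K. \<Sum>d\<in>?L. (cmod (G ?\<gamma> d ?\<beta> c))\<^sup>2)"
      unfolding P_def trace by simp
    show ?thesis
    proof (cases "?\<beta> = ?\<gamma>")
      case True
      have "(\<Sum>d\<in>?L. (cmod (G ?\<gamma> d ?\<beta> c))\<^sup>2) = of_bool (c \<in> ?L)" if "c \<in> ?K" for c
      proof -
        have "(\<Sum>d\<in>?L. (cmod (G ?\<gamma> d ?\<beta> c))\<^sup>2) = (\<Sum>d\<in>?L. if d = c then 1 else 0)"
          using KL that True g_mem(1)[OF i'] by (intro sum.cong refl) (auto simp: G_same subset_eq)
        then show ?thesis using KL by simp
      qed
      then have "Re (mat_trace (P i * P i')) = (\<Sum>c\<in>?K. of_bool (c \<in> ?L))" unfolding Re by simp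
      also have "\<dots> = real (card (?K \<inter> ?L))"
        using KL by (simp add: of_bool_def sum.If_cases)
      finally show ?thesis using True by simp
    next
      case False
      have "(\<Sum>c\<in>?K. \<Sum>d\<in>?L. (cmod (G ?\<gamma> d ?\<beta> c))\<^sup>2) = (\<Sum>c\<in>?K. \<Sum>d\<in>?L. 1 / real m)"
      proof (rule sum.cong[OF refl], rule sum.cong[OF refl])
        fix c d assume "c \<in> ?K" "d \<in> ?L"
        then show "(cmod (G ?\<gamma> d ?\<beta> c))\<^sup>2 = 1 / real m"
          unfolding G_def using KL g_mem(1)[OF i] g_mem(1)[OF i'] False by (intro unbiased) auto
      qed
      then show ?thesis unfolding Re using False KL by (simp add: power2_eq_square)
    qed
  qed
  have "coherence n P = (real l)\<^sup>2 / real m"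
    unfolding coherence_def
  proof (rule Max_eqI)
    let ?S = "{Re (mat_trace (P i * P i')) |i i'. i \<in> {1..n} \<and> i' \<in> {1..n} \<and> i \<noteq> i'}"
    have "?S \<subseteq> (\<lambda>(i, i'). Re (mat_trace (P i * P i'))) ` ({1..n} \<times> {1..n})" by auto
    then show "finite ?S" by (rule finite_subset) simp
    fix y assume "y \<in> ?S"
    then obtain i i' where i: "i \<in> {1..n}" "i' \<in> {1..n}" "i \<noteq> i'" and y: "y = Re (mat_trace (P i * P i'))"
      by (elim CollectE exE conjE) (rule that)
    show "y \<le> (real l)\<^sup>2 / real m"
    proof (cases "fst (g i) = fst (g i')")
      case True
      have "g i \<noteq> g i'" using inj_on_eq_iff[OF bij_betw_imp_inj_on[OF g] i(1,2)] i(3) by simp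
      then have "snd (g i) \<noteq> snd (g i')" using True by (simp add: prod_eq_iff)
      then have "m * card (H (snd (g i)) \<inter> H (snd (g i'))) \<le> l\<^sup>2" by (intro Int g_mem i(1,2))
      then have "real m * real (card (H (snd (g i)) \<inter> H (snd (g i')))) \<le> (real l)\<^sup>2"
        by (simp flip: of_nat_mult of_nat_power)
      then show ?thesis using m True by (simp add: y Re_trace[OF i(1,2)] field_simps)
    qed (simp add: y Re_trace[OF i(1,2)])
  next
    \<comment> \<open>The value is attained by one block taken in two different bases; there are at
      least two bases as \<open>m > 0\<close>.\<close>
    obtain j where j: "j \<in> J" using J0 by (metis all_not_in_conv card.empty less_irrefl)
    have "\<not> is_singleton bases" "bases \<noteq> {}" using bases m by (auto simp: is_singleton_altdef)
    then obtain \<beta> \<gamma> where bg: "\<beta> \<in> bases" "\<gamma> \<in> bases" "\<beta> \<noteq> \<gamma>" by (metis is_singletonI' )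
    obtain i i' where i: "i \<in> {1..n}" "g i = (\<beta>, j)" and i': "i' \<in> {1..n}" "g i' = (\<gamma>, j)"
      using g bg j unfolding bij_betw_def by (metis (no_types, lifting) SigmaI imageE)
    have "(real l)\<^sup>2 / real m = Re (mat_trace (P i * P i'))"
      using Re_trace[OF i(1) i'(1)] i(2) i'(2) bg by simp
    moreover have "i \<noteq> i'" using i i' bg by auto
    ultimately show "(real l)\<^sup>2 / real m \<in>
        {Re (mat_trace (P i * P i')) |i i'. i \<in> {1..n} \<and> i' \<in> {1..n} \<and> i \<noteq> i'}"
      using i(1) i'(1) by (intro CollectI exI conjI)
  qed
  \<comment> \<open>For \<open>m > 0\<close> the truncated subtraction in \<open>d_complex\<close>
    is exact, so the bound is the square of \<open>m\<close>.\<close>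
  moreover have "n > d_complex m + 1" using large m by (simp add: d_complex_def)
  ultimately show ?thesis
    using packing posdef tight unfolding ogff_def fusion_frame_def by blast
qed

section \<open>Chirp bases and hyperplanes with the required parameters\<close>

theorem corollary5p9:
  fixes p t m l n :: nat
  assumes "prime p"
    and "t > 0"
    and "m = p ^ (t + 1)"
    and "l = p ^ t"
    and "n = (p ^ (t + 1) + 1) * (\<Sum>i = 1..t + 1. p ^ i)"
  shows "\<exists>P. ogff m n l P \<and> tight m n l P"
proof -
  let ?k = "t + 1"
  have p0: "p > 0" using assms(1) prime_gt_0_nat by blast
  define bases where "bases = insert None (Some ` box p ?k)"
  \<comment> \<open>The number of normals, which is also the number of hyperplanes through a
    point.\<close>
  define r where "r = (\<Sum>i<?k. p ^ i)"
  define J where "J = normals p ?k \<times> {0..<int p}"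
  define H where "H = (\<lambda>(c, s). hyperplane p ?k c s)"
  from ex_mutually_unbiased_bases[OF assms(1), of ?k] obtain
    v :: "(nat \<Rightarrow> int) option \<Rightarrow> (nat \<Rightarrow> int) \<Rightarrow> (nat \<Rightarrow> int) \<Rightarrow> complex" where
    ortho: "\<forall>\<beta>\<in>bases. \<forall>b\<in>box p ?k. \<forall>c\<in>box p ?k.
      (\<Sum>x\<in>box p ?k. v \<beta> b x * cnj (v \<beta> c x)) = of_bool (b = c)" and
    complete: "\<forall>\<beta>\<in>bases. \<forall>x\<in>box p ?k. \<forall>y\<in>box p ?k.
      (\<Sum>b\<in>box p ?k. v \<beta> b x * cnj (v \<beta> b y)) = of_bool (x = y)" and
    unbiased: "\<forall>\<beta>\<in>bases. \<forall>\<gamma>\<in>bases. \<beta> \<noteq> \<gamma> \<longrightarrow> (\<forall>b\<in>box p ?k. \<forall>c\<in>box p ?k.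
      (cmod (\<Sum>x\<in>box p ?k. v \<beta> b x * cnj (v \<gamma> c x)))\<^sup>2 = 1 / real (p ^ ?k))"
    unfolding bases_def[symmetric] by auto
  have card_bases: "card bases = m + 1"
    unfolding bases_def
    by (subst card_insert_disjoint) (auto simp: finite_box card_image card_box assms(3))
  have finite_normals: "finite (normals p ?k)"
    using normals_subset[OF prime_gt_1_nat[OF assms(1)]] finite_box finite_subset by blast
  have card_J: "card J = r * p"
    by (simp add: J_def card_cartesian_product card_normals r_def)
  \<comment> \<open>The \<open>p\<close> offsets belonging to each normal supply the factor that
    raises all exponents by one.\<close>
  have "(\<Sum>i = 1..k. p ^ i) = p * (\<Sum>i<k. p ^ i)" for k
    by (induction k) (auto simp: algebra_simps)
  then have n: "n = (m + 1) * card J"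
    by (simp only: assms card_J r_def mult.commute)
  have card_H: "card (H j) = l" if "j \<in> J" for j
  proof -
    from that obtain c s where "c \<in> normals p ?k" "s \<in> {0..<int p}" and "j = (c, s)"
      unfolding J_def by (rule SigmaE)
    then have j: "j = (c, s)" "c \<in> normals p ?k" by simp_all
    have "p * card (H j) = p * l"
      using card_hyperplane[OF assms(1) j(2)] by (simp add: j(1) H_def assms(4))
    then show ?thesis using p0 by simp
  qed
  show ?thesis
  proof (rule ogff_of_mutually_unbiased_bases[where X = "box p ?k" and J = J and H = H and v = v])
    show "m * card (H i \<inter> H j) \<le> l\<^sup>2" if ij: "i \<in> J" "j \<in> J" "i \<noteq> j" for i j
    proof -
      from ij(1) obtain c s where "c \<in> normals p ?k" "s \<in> {0..<int p}" and "i = (c, s)"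
        unfolding J_def by (rule SigmaE)
      then have i: "i = (c, s)" "c \<in> normals p ?k" "s \<in> {0..<int p}" by simp_all
      from ij(2) obtain c' s' where "c' \<in> normals p ?k" "s' \<in> {0..<int p}" and "j = (c', s')"
        unfolding J_def by (rule SigmaE)
      then have j: "j = (c', s')" "c' \<in> normals p ?k" "s' \<in> {0..<int p}" by simp_all
      show ?thesis
      proof (cases "c = c'")
        case True
        then have "s \<noteq> s'" using i j ij by simp
        then have "H i \<inter> H j = {}"
          using hyperplane_Int_parallel[OF i(3) j(3)] by (simp add: H_def i j True)
        then show ?thesis by simp
      next
        case False
        have "p\<^sup>2 * card (H i \<inter> H j) = p * p ^ t"
          using card_hyperplane_Int[OF assms(1) i(2) j(2) False] by (simp add: H_def i j)
        \<comment> \<open>Non-parallel hyperplanes meet the bound with equality: \<open>m\<close> is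
          \<open>p * p ^ t\<close>, and the intersection has \<open>p ^ t / p\<close>
          points.\<close>
        then have "p * card (H i \<inter> H j) = p ^ t"
          using p0 by (simp add: power2_eq_square)
        then have "m * card (H i \<inter> H j) = p ^ t * p ^ t"
          by (simp add: assms(3) mult.commute mult.left_commute)
        then show ?thesis by (simp add: assms(4) power2_eq_square)
      qed
    qed
    show "card {j \<in> J. x \<in> H j} = r" if "x \<in> box p ?k" for x
    proof -
      have "{j \<in> J. x \<in> H j} = {(c, s) \<in> normals p ?k \<times> {0..<int p}. x \<in> hyperplane p ?k c s}"
        by (auto simp: J_def H_def)
      then show ?thesis using card_hyperplanes_through[OF p0 that] by (simp add: card_normals r_def)
    qed
    \<comment> \<open>The summand \<open>p ^ t\<close> of \<open>r\<close> alone accounts for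
      \<open>m\<close> blocks, so \<open>n\<close> is at least \<open>(m + 1) * m\<close>, which
      exceeds the square of \<open>m\<close>.\<close>
    have "m \<le> card J"
    proof -
      have "p ^ t \<le> r" unfolding r_def by (rule member_le_sum) auto
      then show ?thesis by (simp add: card_J assms(3))
    qed
    then have "(m + 1) * m \<le> n" unfolding n by (rule mult_le_mono2)
    moreover show "m > 0" using p0 by (simp add: assms(3))
    ultimately show "n > m\<^sup>2" by (simp add: power2_eq_square)
    show "m * r = card J * l" by (simp add: card_J assms)
    show "finite J" unfolding J_def using finite_normals by (rule finite_cartesian_product) simp
    show "finite bases" by (simp add: bases_def finite_box)
    show "H j \<subseteq> box p ?k" if "j \<in> J" for j by (auto simp: H_def hyperplane_def split: prod.splits)
    show "(cmod (\<Sum>x\<in>box p ?k. v \<beta> b x * cnj (v \<gamma> c x)))\<^sup>2 = 1 / real m"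
      if "\<beta> \<in> bases" "\<gamma> \<in> bases" "\<beta> \<noteq> \<gamma>" "b \<in> box p ?k" "c \<in> box p ?k" for \<beta> \<gamma> b c
      using unbiased that unfolding assms(3) by blast
    show "l > 0" using p0 by (simp add: assms(4))
    show "card (box p ?k) = m" by (simp only: card_box assms(3))
  qed (use ortho complete finite_box card_bases card_H n in blast)+
qed

end
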